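(* Let $\mathcal{A}$ be a semi-abelian category. Then the following conditions are equivalent: (SM) every star-multiplicative reflexive graph in $\mathcal{A}$ is multiplicative; (SH) two (effective) equivalence relations on a common object of $\mathcal{A}$ commute (in the sense of Smith) if and only if their normalisations commute (in the sense of Huq).
   Context: A pointed category (one with a zero object) is (Bourn) protomodular when it is finitely complete and the Split Short Five Lemma holds: given split epimorphisms $f\colon A\to B$ with section $s$ and $f'\colon A'\to B'$ with section $s'$, with kernels $\ker f\colon K[f]\to A$ and $\ker f'\colon K[f']\to A'$, and morphisms $k\colon K[f]\to K[f']$, $a\colon A\to A'$, $b\colon B\to B'$ with $a\ker f=\ker f'\,k$, $bf=f'a$, $s'b=as$, if $k$ and $b$ are isomorphisms then so is $a$. An equivalence relation is effective when it is a kernel pair. A category is Barr exact when it is regular (finitely complete, with pullback-stable regular epimorphisms and coequalisers of effective equivalence relations) and every internal equivalence relation is effective. A category is semi-abelian when it is pointed, protomodular, Barr exact and has binary coproducts. (So in a semi-abelian category all equivalence relations are effective.) A reflexive graph $C=(C_1,C_0,d,c,e)$ consists of morphisms $d,c\colon C_1\to C_0$ (domain and codomain) and $e\colon C_0\to C_1$ with $de=ce=1_{C_0}$. Let $k=\ker d\colon X\to C_1$ and $h=ck\colon X\to C_0$, and let $C_1\times_{C_0}X$, with projections $\pi_0$ to $C_1$ and $\pi_1$ to $X$, be the pullback of $d$ and $h$ (so $d\pi_0=h\pi_1$). The graph $C$ is star-multiplicative when there is a (necessarily unique) morphism $\varsigma\colon C_1\times_{C_0}X\to X$ such that $\varsigma\langle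 k,0\rangle=1_X$ and $\varsigma\langle eck,1_X\rangle=1_X$. A reflexive graph is multiplicative when it carries the structure of an internal category, i.e. it is the underlying reflexive graph of an internal category; in a semi-abelian category internal categories and internal groupoids coincide. Two morphisms $k\colon X\to A$ and $l\colon Y\to A$ commute in the sense of Huq when there is a (necessarily unique) morphism $\varphi\colon X\times Y\to A$ with $\varphi\langle 1_X,0\rangle=k$ and $\varphi\langle 0,1_Y\rangle=l$. Let $(R,r_0,r_1,\Delta_R)$ and $(S,s_0,s_1,\Delta_S)$ be equivalence relations on an object $A$, where $r_0,r_1\colon R\to A$ and $s_0,s_1\colon S\to A$ are the projections and $\Delta_R\colon A\to R$, $\Delta_S\colon A\to S$ the reflexivity morphisms. Let $R\times_A S$ be the pullback of $r_1$ and $s_0$. The pair $(R,S)$ commutes in the sense of Smith when there is a (necessarily unique) morphism $\theta\colon R\times_A S\to A$ with $\theta\langle 1_R,\Delta_S r_1\rangle=r_0$ and $\theta\langle \Delta_R s_0,1_S\rangle=s_1$. The normalisation of $R$ is the morphism $r_1\ker r_0\colon K[r_0]\to A$, and the normalisation of $S$ is the morphism $s_1\ker s_0\colon K[s_0]\to A$. *)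

theory Defs
  imports Main
begin

record ('o, 'm) precategory =
  Obj :: "'o set"
  Arr :: "'m set"
  Dom :: "'m \<Rightarrow> 'o"
  Cod :: "'m \<Rightarrow> 'o"
  Id :: "'o \<Rightarrow> 'm"
  Comp :: "'m \<Rightarrow> 'm \<Rightarrow> 'm"  (infixl "\<cdot>\<index>" 70)

(* g \<cdot> f is "g after f". Dom, Cod, Id and Comp are total functions whose values are
   relevant only on Obj, on Arr and on composable pairs; every notion below constrains
   arrows through hom-sets. *)

definition hom :: "('o, 'm) precategory \<Rightarrow> 'o \<Rightarrow> 'o \<Rightarrow> 'm set" where
  "hom C X Y = {f \<in> Arr C. Dom C f = X \<and> Cod C f = Y}"

locale category =
  fixes C :: "('o, 'm) precategory" (structure)
  assumes Dom_in_Obj: "f \<in> Arr C \<Longrightarrow> Dom C f \<in> Obj C"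
    and Cod_in_Obj: "f \<in> Arr C \<Longrightarrow> Cod C f \<in> Obj C"
    and Id_in_hom: "X \<in> Obj C \<Longrightarrow> Id C X \<in> hom C X X"
    and Comp_in_hom: "f \<in> hom C X Y \<Longrightarrow> g \<in> hom C Y Z \<Longrightarrow> g \<cdot> f \<in> hom C X Z"
    and Comp_Id: "f \<in> hom C X Y \<Longrightarrow> f \<cdot> Id C X = f"
    and Id_Comp: "f \<in> hom C X Y \<Longrightarrow> Id C Y \<cdot> f = f"
    and Comp_assoc: "f \<in> hom C W X \<Longrightarrow> g \<in> hom C X Y \<Longrightarrow> h \<in> hom C Y Z \<Longrightarrow>
      (h \<cdot> g) \<cdot> f = h \<cdot> (g \<cdot> f)"

definition is_functor ::
  "('a, 'b) precategory \<Rightarrow> ('o, 'm) precategory \<Rightarrow> ('a \<Rightarrow> 'o) \<Rightarrow> ('b \<Rightarrow> 'm) \<Rightarrow> bool" where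
  "is_functor J C Fo Fa \<longleftrightarrow>
     (\<forall>i \<in> Obj J. Fo i \<in> Obj C \<and> Fa (Id J i) = Id C (Fo i)) \<and>
     (\<forall>i j. \<forall>a \<in> hom J i j. Fa a \<in> hom C (Fo i) (Fo j)) \<and>
     (\<forall>i j l. \<forall>a \<in> hom J i j. \<forall>b \<in> hom J j l. Fa (b \<cdot>\<^bsub>J\<^esub> a) = Fa b \<cdot>\<^bsub>C\<^esub> Fa a)"

definition is_cone ::
  "('a, 'b) precategory \<Rightarrow> ('o, 'm) precategory \<Rightarrow> ('a \<Rightarrow> 'o) \<Rightarrow> ('b \<Rightarrow> 'm) \<Rightarrow>
     'o \<Rightarrow> ('a \<Rightarrow> 'm) \<Rightarrow> bool" where
  "is_cone J C Fo Fa L p \<longleftrightarrow> L \<in> Obj C \<and>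
     (\<forall>i \<in> Obj J. p i \<in> hom C L (Fo i)) \<and>
     (\<forall>i j. \<forall>a \<in> hom J i j. Fa a \<cdot>\<^bsub>C\<^esub> p i = p j)"

definition is_limit ::
  "('a, 'b) precategory \<Rightarrow> ('o, 'm) precategory \<Rightarrow> ('a \<Rightarrow> 'o) \<Rightarrow> ('b \<Rightarrow> 'm) \<Rightarrow>
     'o \<Rightarrow> ('a \<Rightarrow> 'm) \<Rightarrow> bool" where
  "is_limit J C Fo Fa L p \<longleftrightarrow> is_cone J C Fo Fa L p \<and>
     (\<forall>W q. is_cone J C Fo Fa W q \<longrightarrow>
        (\<exists>!u. u \<in> hom C W L \<and> (\<forall>i \<in> Obj J. p i \<cdot>\<^bsub>C\<^esub> u = q i)))"

(* Every finite category is isomorphic to one whose objects and arrows are natural numbers. *)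
definition finitely_complete :: "('o, 'm) precategory \<Rightarrow> bool" where
  "finitely_complete C \<longleftrightarrow>
     (\<forall>(J :: (nat, nat) precategory) Fo Fa.
        category J \<and> finite (Obj J) \<and> finite (Arr J) \<and> is_functor J C Fo Fa \<longrightarrow>
        (\<exists>L p. is_limit J C Fo Fa L p))"

context
  fixes C :: "('o, 'm) precategory" (structure)
begin

definition is_iso :: "'m \<Rightarrow> bool" where
  "is_iso f \<longleftrightarrow> f \<in> Arr C \<and>
     (\<exists>g \<in> hom C (Cod C f) (Dom C f). g \<cdot> f = Id C (Dom C f) \<and> f \<cdot> g = Id C (Cod C f))"

definition is_zero_object :: "'o \<Rightarrow> bool" where
  "is_zero_object Z \<longleftrightarrow> Z \<in> Obj C \<and>
     (\<forall>X \<in> Obj C. (\<exists>!f. f \<in> hom C X Z) \<and> (\<exists>!f. f \<in> hom C Z X))"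

definition pointed :: bool where
  "pointed \<longleftrightarrow> (\<exists>Z. is_zero_object Z)"

definition zero_arr :: "'o \<Rightarrow> 'o \<Rightarrow> 'm" where
  "zero_arr X Y =
     (THE z. \<exists>Z u v. is_zero_object Z \<and> u \<in> hom C X Z \<and> v \<in> hom C Z Y \<and> z = v \<cdot> u)"

definition is_kernel :: "'m \<Rightarrow> 'o \<Rightarrow> 'm \<Rightarrow> bool" where
  "is_kernel f K k \<longleftrightarrow> f \<in> Arr C \<and> k \<in> hom C K (Dom C f) \<and>
     f \<cdot> k = zero_arr K (Cod C f) \<and>
     (\<forall>W. \<forall>a \<in> hom C W (Dom C f). f \<cdot> a = zero_arr W (Cod C f) \<longrightarrow>
        (\<exists>!u. u \<in> hom C W K \<and> k \<cdot> u = a))"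

definition is_product :: "'o \<Rightarrow> 'o \<Rightarrow> 'o \<Rightarrow> 'm \<Rightarrow> 'm \<Rightarrow> bool" where
  "is_product X Y P p q \<longleftrightarrow> p \<in> hom C P X \<and> q \<in> hom C P Y \<and>
     (\<forall>W. \<forall>a \<in> hom C W X. \<forall>b \<in> hom C W Y.
        (\<exists>!u. u \<in> hom C W P \<and> p \<cdot> u = a \<and> q \<cdot> u = b))"

definition is_coproduct :: "'o \<Rightarrow> 'o \<Rightarrow> 'o \<Rightarrow> 'm \<Rightarrow> 'm \<Rightarrow> bool" where
  "is_coproduct X Y S i j \<longleftrightarrow> i \<in> hom C X S \<and> j \<in> hom C Y S \<and>
     (\<forall>W. \<forall>a \<in> hom C X W. \<forall>b \<in> hom C Y W.
        (\<exists>!u. u \<in> hom C S W \<and> u \<cdot> i = a \<and> u \<cdot> j = b))"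

definition has_binary_coproducts :: bool where
  "has_binary_coproducts \<longleftrightarrow>
     (\<forall>X \<in> Obj C. \<forall>Y \<in> Obj C. \<exists>S i j. is_coproduct X Y S i j)"

definition is_pullback :: "'m \<Rightarrow> 'm \<Rightarrow> 'o \<Rightarrow> 'm \<Rightarrow> 'm \<Rightarrow> bool" where
  "is_pullback f g P p q \<longleftrightarrow>
     f \<in> Arr C \<and> g \<in> Arr C \<and> Cod C f = Cod C g \<and>
     p \<in> hom C P (Dom C f) \<and> q \<in> hom C P (Dom C g) \<and> f \<cdot> p = g \<cdot> q \<and>
     (\<forall>W. \<forall>a \<in> hom C W (Dom C f). \<forall>b \<in> hom C W (Dom C g). f \<cdot> a = g \<cdot> b \<longrightarrow>
        (\<exists>!u. u \<in> hom C W P \<and> p \<cdot> u = a \<and> q \<cdot> u = b))"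

(* pairing p q a b is the arrow <a, b> into the (fibre) product with projections p and q. *)
definition pairing :: "'m \<Rightarrow> 'm \<Rightarrow> 'm \<Rightarrow> 'm \<Rightarrow> 'm" where
  "pairing p q a b = (THE u. u \<in> hom C (Dom C a) (Dom C p) \<and> p \<cdot> u = a \<and> q \<cdot> u = b)"

definition is_coequaliser :: "'m \<Rightarrow> 'm \<Rightarrow> 'm \<Rightarrow> bool" where
  "is_coequaliser u v q \<longleftrightarrow>
     u \<in> Arr C \<and> v \<in> Arr C \<and> Dom C u = Dom C v \<and> Cod C u = Cod C v \<and>
     q \<in> Arr C \<and> Dom C q = Cod C u \<and> q \<cdot> u = q \<cdot> v \<and>
     (\<forall>W. \<forall>t \<in> hom C (Cod C u) W. t \<cdot> u = t \<cdot> v \<longrightarrow>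
        (\<exists>!w. w \<in> hom C (Cod C q) W \<and> w \<cdot> q = t))"

definition regular_epi :: "'m \<Rightarrow> bool" where
  "regular_epi q \<longleftrightarrow> (\<exists>u v. is_coequaliser u v q)"

definition jointly_monic :: "'o \<Rightarrow> 'm \<Rightarrow> 'm \<Rightarrow> bool" where
  "jointly_monic R r0 r1 \<longleftrightarrow>
     (\<forall>W. \<forall>a \<in> hom C W R. \<forall>b \<in> hom C W R. r0 \<cdot> a = r0 \<cdot> b \<and> r1 \<cdot> a = r1 \<cdot> b \<longrightarrow> a = b)"

(* Here and below, a kernel, product or pullback used inside a definition is chosen
   existentially. In a finitely complete pointed category the choice does not matter, since
   these limits exist and are unique up to isomorphism. *)
definition equivalence_relation :: "'o \<Rightarrow> 'o \<Rightarrow> 'm \<Rightarrow> 'm \<Rightarrow> 'm \<Rightarrow> bool" where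
  "equivalence_relation A R r0 r1 \<Delta> \<longleftrightarrow>
     r0 \<in> hom C R A \<and> r1 \<in> hom C R A \<and> jointly_monic R r0 r1 \<and>
     (\<Delta> \<in> hom C A R \<and> r0 \<cdot> \<Delta> = Id C A \<and> r1 \<cdot> \<Delta> = Id C A) \<and>
     (\<exists>\<sigma> \<in> hom C R R. r0 \<cdot> \<sigma> = r1 \<and> r1 \<cdot> \<sigma> = r0) \<and>
     (\<exists>P p q. is_pullback r1 r0 P p q \<and>
        (\<exists>\<tau> \<in> hom C P R. r0 \<cdot> \<tau> = r0 \<cdot> p \<and> r1 \<cdot> \<tau> = r1 \<cdot> q))"

definition effective :: "'o \<Rightarrow> 'o \<Rightarrow> 'm \<Rightarrow> 'm \<Rightarrow> bool" where
  "effective A R r0 r1 \<longleftrightarrow> (\<exists>B. \<exists>f \<in> hom C A B. is_pullback f f R r0 r1)"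

definition regular :: bool where
  "regular \<longleftrightarrow> finitely_complete C \<and>
     (\<forall>f g P p q. is_pullback f g P p q \<and> regular_epi f \<longrightarrow> regular_epi q) \<and>
     (\<forall>A R r0 r1 \<Delta>. equivalence_relation A R r0 r1 \<Delta> \<and> effective A R r0 r1 \<longrightarrow>
        (\<exists>q. is_coequaliser r0 r1 q))"

definition barr_exact :: bool where
  "barr_exact \<longleftrightarrow> regular \<and>
     (\<forall>A R r0 r1 \<Delta>. equivalence_relation A R r0 r1 \<Delta> \<longrightarrow> effective A R r0 r1)"

definition split_epi :: "'o \<Rightarrow> 'o \<Rightarrow> 'm \<Rightarrow> 'm \<Rightarrow> bool" where
  "split_epi A B f s \<longleftrightarrow> f \<in> hom C A B \<and> s \<in> hom C B A \<and> f \<cdot> s = Id C B"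

definition split_short_five_lemma :: bool where
  "split_short_five_lemma \<longleftrightarrow>
     (\<forall>A B f s K i A' B' f' s' K' i' k a b.
        split_epi A B f s \<and> is_kernel f K i \<and>
        split_epi A' B' f' s' \<and> is_kernel f' K' i' \<and>
        k \<in> hom C K K' \<and> a \<in> hom C A A' \<and> b \<in> hom C B B' \<and>
        a \<cdot> i = i' \<cdot> k \<and> b \<cdot> f = f' \<cdot> a \<and> s' \<cdot> b = a \<cdot> s \<and>
        is_iso k \<and> is_iso b \<longrightarrow> is_iso a)"

definition protomodular :: bool where
  "protomodular \<longleftrightarrow> pointed \<and> finitely_complete C \<and> split_short_five_lemma"

definition semi_abelian :: bool where
  "semi_abelian \<longleftrightarrow>
     category C \<and> pointed \<and> protomodular \<and> barr_exact \<and> has_binary_coproducts"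

definition reflexive_graph :: "'o \<Rightarrow> 'o \<Rightarrow> 'm \<Rightarrow> 'm \<Rightarrow> 'm \<Rightarrow> bool" where
  "reflexive_graph C1 C0 d c e \<longleftrightarrow>
     d \<in> hom C C1 C0 \<and> c \<in> hom C C1 C0 \<and> e \<in> hom C C0 C1 \<and>
     d \<cdot> e = Id C C0 \<and> c \<cdot> e = Id C C0"

definition star_multiplicative :: "'o \<Rightarrow> 'o \<Rightarrow> 'm \<Rightarrow> 'm \<Rightarrow> 'm \<Rightarrow> bool" where
  "star_multiplicative C1 C0 d c e \<longleftrightarrow> reflexive_graph C1 C0 d c e \<and>
     (\<exists>X k P p0 p1. is_kernel d X k \<and> is_pullback d (c \<cdot> k) P p0 p1 \<and>
        (\<exists>\<sigma> \<in> hom C P X.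
           \<sigma> \<cdot> pairing p0 p1 k (zero_arr X X) = Id C X \<and>
           \<sigma> \<cdot> pairing p0 p1 (e \<cdot> c \<cdot> k) (Id C X) = Id C X))"

(* P is the object of composable pairs (g, f) with d g = c f, and m sends (g, f) to "g after f".
   T is the object of composable triples, given as pairs ((h, g), (g, f)). *)
definition internal_category ::
  "'o \<Rightarrow> 'o \<Rightarrow> 'm \<Rightarrow> 'm \<Rightarrow> 'm \<Rightarrow> 'o \<Rightarrow> 'm \<Rightarrow> 'm \<Rightarrow> 'm \<Rightarrow> bool" where
  "internal_category C1 C0 d c e P p0 p1 m \<longleftrightarrow>
     reflexive_graph C1 C0 d c e \<and> is_pullback d c P p0 p1 \<and> m \<in> hom C P C1 \<and>
     d \<cdot> m = d \<cdot> p1 \<and> c \<cdot> m = c \<cdot> p0 \<and>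
     m \<cdot> pairing p0 p1 (Id C C1) (e \<cdot> d) = Id C C1 \<and>
     m \<cdot> pairing p0 p1 (e \<cdot> c) (Id C C1) = Id C C1 \<and>
     (\<exists>T q0 q1. is_pullback p1 p0 T q0 q1 \<and>
        m \<cdot> pairing p0 p1 (p0 \<cdot> q0) (m \<cdot> q1) = m \<cdot> pairing p0 p1 (m \<cdot> q0) (p1 \<cdot> q1))"

definition multiplicative :: "'o \<Rightarrow> 'o \<Rightarrow> 'm \<Rightarrow> 'm \<Rightarrow> 'm \<Rightarrow> bool" where
  "multiplicative C1 C0 d c e \<longleftrightarrow>
     (\<exists>P p0 p1 m. internal_category C1 C0 d c e P p0 p1 m)"

definition huq_commute :: "'o \<Rightarrow> 'm \<Rightarrow> 'm \<Rightarrow> bool" where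
  "huq_commute A k l \<longleftrightarrow>
     (\<exists>X Y P p q. k \<in> hom C X A \<and> l \<in> hom C Y A \<and> is_product X Y P p q \<and>
        (\<exists>\<phi> \<in> hom C P A.
           \<phi> \<cdot> pairing p q (Id C X) (zero_arr X Y) = k \<and>
           \<phi> \<cdot> pairing p q (zero_arr Y X) (Id C Y) = l))"

definition smith_commute ::
  "'o \<Rightarrow> 'o \<Rightarrow> 'm \<Rightarrow> 'm \<Rightarrow> 'm \<Rightarrow> 'o \<Rightarrow> 'm \<Rightarrow> 'm \<Rightarrow> 'm \<Rightarrow> bool" where
  "smith_commute A R r0 r1 \<Delta>R S s0 s1 \<Delta>S \<longleftrightarrow>
     (\<exists>P p q. is_pullback r1 s0 P p q \<and>
        (\<exists>\<theta> \<in> hom C P A.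
           \<theta> \<cdot> pairing p q (Id C R) (\<Delta>S \<cdot> r1) = r0 \<and>
           \<theta> \<cdot> pairing p q (\<Delta>R \<cdot> s0) (Id C S) = s1))"

definition is_normalisation :: "'m \<Rightarrow> 'm \<Rightarrow> 'm \<Rightarrow> bool" where
  "is_normalisation r0 r1 n \<longleftrightarrow> (\<exists>K k. is_kernel r0 K k \<and> n = r1 \<cdot> k)"

end

end

theory Submission
  imports Defs
begin

text \<open>
  Arrows \<open>W \<rightarrow> A\<close> are treated below as elements of \<open>A\<close>, and arrows out of \<open>A\<close> as functions of
  such elements. Two consequences of the Split Short Five Lemma carry the argument. Let
  \<open>f : A \<rightarrow> B\<close> be split by \<open>s\<close>, with kernel \<open>i\<close>.

  \<^item> A monic through which both \<open>i\<close> and \<open>s\<close> factor is invertible (\<open>iso_if_monic_and_lifts\<close>). Hence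
    \<open>u a\<close> and \<open>v a\<close> are related by an internal relation for all \<open>a\<close> in \<open>A\<close> once they are for the
    \<open>a\<close> in the images of \<open>i\<close> and \<open>s\<close> (\<open>relation_lift\<close>); for the identity relation this says that
    \<open>i\<close> and \<open>s\<close> are jointly epic (\<open>jointly_epic\<close>).
  \<^item> A morphism of split epimorphisms that is invertible on the base and takes a kernel to a kernel
    is invertible (\<open>iso_if_iso_on_base_and_kernel\<close>). This produces arrows going backwards.

  \<^bold>\<open>(SM) implies (SH).\<close> If \<open>R\<close> and \<open>S\<close> commute through \<open>\<theta>\<close>, then their normalisations commute
  through \<open>\<phi>(k, l) = \<theta>((k, 0), (0, l))\<close>. Conversely, let \<open>R\<close> and \<open>S\<close> have normalisations \<open>K\<close> and
  \<open>L\<close> that commute through \<open>\<phi>\<close>. Consider the reflexive graph on \<open>A\<close> whose arrows \<open>x \<rightarrow> z\<close> are the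
  zigzags \<open>x R y S z\<close>. The zigzags \<open>0 R y S z\<close> are parametrised by \<open>K \<times> L\<close>, through \<open>z = \<phi>(y, l)\<close>;
  those prolonged by a step \<open>z R u\<close> are parametrised by \<open>(K \<times> L) \<times> K\<close>, through \<open>u = \<phi>(p, l)\<close>.
  Inverting the second parametrisation gives a fourth vertex \<open>p\<close> with \<open>0 R p S u\<close>, so \<open>0 R y S z\<close>
  followed by \<open>z R u S v\<close> has the composite \<open>0 R p S v\<close>. Thus the graph is star-multiplicative
  (\<open>zigzag_graph_star_multiplicative\<close>), hence multiplicative by (SM), and composing the zigzags
  \<open>z R z S y\<close> and \<open>y R x S x\<close> yields \<open>z R \<theta> S x\<close>, whose middle vertex \<open>\<theta>(x, y, z)\<close> shows that \<open>R\<close>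
  and \<open>S\<close> commute.

  \<^bold>\<open>(SH) implies (SM).\<close> Let \<open>\<sigma>\<close> be the star multiplication of a reflexive graph, \<open>\<sigma>(g, f) = g f\<close> for
  \<open>f\<close> in \<open>X = Ker d\<close>. The map \<open>(g, f) \<mapsto> (g f, f)\<close> onto \<open>X \<times> X\<close> is invertible, so there is a division
  \<open>\<delta>(x, f) = x f\<^sup>-\<^sup>1\<close>. Let \<open>y\<close> be in \<open>Y = Ker c\<close>. If there is an \<open>f\<close> in \<open>X\<close> with \<open>c f = d y\<close>, then
  \<open>n = y f\<close> is an endomorphism of \<open>0\<close>, and \<open>(x, y, f) \<mapsto> (x n) f\<^sup>-\<^sup>1\<close> restricts to \<open>x\<close> and to \<open>y\<close>. The
  pairs \<open>(y, f)\<close> form an object \<open>E\<close>, and \<open>E \<rightarrow> Y\<close> is a regular epimorphism, which is where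
  regularity enters; a Huq commutation descends along it (\<open>huq_commute_along_regular_epi\<close>). So the
  kernels of \<open>d\<close> and \<open>c\<close> commute (\<open>huq_commute_if_star_multiplicative\<close>). They are the normalisations
  of the kernel pairs of \<open>d\<close> and \<open>c\<close>, which therefore commute by (SH), through some \<open>\<theta>\<close>. Finally
  \<open>(g, f) \<mapsto> \<theta>(g, e d g, f)\<close> is an internal category structure
  (\<open>multiplicative_if_kernel_pairs_smith_commute\<close>).
\<close>

section \<open>Categories\<close>

context category
begin

lemma hom_iff [simp]: "f \<in> hom C X Y \<longleftrightarrow> f \<in> Arr C \<and> Dom C f = X \<and> Cod C f = Y"
  by (auto simp: hom_def)

lemma Obj_if_arr:
  assumes "f \<in> Arr C" "Dom C f = X" "Cod C f = Y"
  shows "X \<in> Obj C" "Y \<in> Obj C"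
  using assms Dom_in_Obj Cod_in_Obj by auto

lemma Id_arr [simp]:
  assumes "X \<in> Obj C"
  shows "Id C X \<in> Arr C" "Dom C (Id C X) = X" "Cod C (Id C X) = X"
  using Id_in_hom[OF assms] by auto

lemma comp_arr [simp]:
  assumes "f \<in> Arr C" "g \<in> Arr C" "Cod C f = Dom C g"
  shows "g \<cdot> f \<in> Arr C" "Dom C (g \<cdot> f) = Dom C f" "Cod C (g \<cdot> f) = Cod C g"
  using Comp_in_hom[of f "Dom C f" "Cod C f" g "Cod C g"] assms by auto

lemma comp_id [simp]: "f \<in> Arr C \<Longrightarrow> Dom C f = X \<Longrightarrow> f \<cdot> Id C X = f"
  using Comp_Id[of f X "Cod C f"] by auto

lemma id_comp [simp]: "f \<in> Arr C \<Longrightarrow> Cod C f = X \<Longrightarrow> Id C X \<cdot> f = f"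
  using Id_Comp[of f "Dom C f" X] by auto

lemma comp_assoc [simp]:
  "f \<in> Arr C \<Longrightarrow> g \<in> Arr C \<Longrightarrow> h \<in> Arr C \<Longrightarrow> Cod C f = Dom C g \<Longrightarrow> Cod C g = Dom C h \<Longrightarrow>
    (h \<cdot> g) \<cdot> f = h \<cdot> (g \<cdot> f)"
  using Comp_assoc[of f "Dom C f" "Cod C f" g "Cod C g" h "Cod C h"] by auto

text \<open>The form of an equation that rewrites inside a composite bracketed to the right, as \<open>comp_assoc\<close>
  brackets them.\<close>

lemma comp_reduce:
  "g \<cdot> f = h \<Longrightarrow> f \<in> Arr C \<Longrightarrow> g \<in> Arr C \<Longrightarrow> Cod C f = Dom C g \<Longrightarrow> w \<in> Arr C \<Longrightarrow>
    Cod C w = Dom C f \<Longrightarrow> g \<cdot> (f \<cdot> w) = h \<cdot> w"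
  using comp_assoc[of w f g] by auto

lemma is_isoE:
  assumes "is_iso C f" "f \<in> hom C X Y"
  obtains g where "g \<in> hom C Y X" "g \<cdot> f = Id C X" "f \<cdot> g = Id C Y"
  using assms unfolding is_iso_def by auto

lemma iso_Id: "X \<in> Obj C \<Longrightarrow> is_iso C (Id C X)"
  unfolding is_iso_def by (auto intro!: exI[of _ "Id C X"])

definition monic :: "'m \<Rightarrow> bool" where
  "monic m \<longleftrightarrow> m \<in> Arr C \<and>
     (\<forall>W. \<forall>a \<in> hom C W (Dom C m). \<forall>b \<in> hom C W (Dom C m). m \<cdot> a = m \<cdot> b \<longrightarrow> a = b)"

lemma monicD:
  assumes "monic m" "a \<in> hom C W (Dom C m)" "b \<in> hom C W (Dom C m)" "m \<cdot> a = m \<cdot> b"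
  shows "a = b"
  using assms unfolding monic_def by blast

lemma jointly_monicD:
  assumes "jointly_monic C R r s" "a \<in> hom C W R" "b \<in> hom C W R" "r \<cdot> a = r \<cdot> b" "s \<cdot> a = s \<cdot> b"
  shows "a = b"
  using assms unfolding jointly_monic_def by blast

subsection \<open>Pullbacks\<close>

lemma pullback_arr:
  assumes "is_pullback C f g P p q"
  shows "f \<in> Arr C" "g \<in> Arr C" "p \<in> Arr C" "q \<in> Arr C" "Cod C g = Cod C f"
    "Dom C p = P" "Cod C p = Dom C f" "Dom C q = P" "Cod C q = Dom C g" "P \<in> Obj C"
  using assms Dom_in_Obj unfolding is_pullback_def by auto

lemma pullback_comm: "is_pullback C f g P p q \<Longrightarrow> f \<cdot> p = g \<cdot> q"
  unfolding is_pullback_def by auto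

lemma pullback_lift:
  assumes "is_pullback C f g P p q" "a \<in> hom C W (Dom C f)" "b \<in> hom C W (Dom C g)" "f \<cdot> a = g \<cdot> b"
  obtains u where "u \<in> Arr C" "Dom C u = W" "Cod C u = P" "p \<cdot> u = a" "q \<cdot> u = b"
  using assms unfolding is_pullback_def by (metis hom_iff)

lemma pullback_ext:
  assumes "is_pullback C f g P p q" "u \<in> hom C W P" "v \<in> hom C W P" "p \<cdot> u = p \<cdot> v" "q \<cdot> u = q \<cdot> v"
  shows "u = v"
proof -
  note [simp] = pullback_arr[OF assms(1)]
  have "f \<cdot> (p \<cdot> v) = g \<cdot> (q \<cdot> v)"
    using assms(3) pullback_comm[OF assms(1)] by (simp flip: comp_assoc)
  then have "\<exists>!u. u \<in> hom C W P \<and> p \<cdot> u = p \<cdot> v \<and> q \<cdot> u = q \<cdot> v"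
    using assms(1,3) unfolding is_pullback_def by auto
  then show ?thesis
    using assms by blast
qed

lemma pullbackI:
  assumes "p \<in> hom C P X" "q \<in> hom C P Y" "f \<in> hom C X Z" "g \<in> hom C Y Z" "f \<cdot> p = g \<cdot> q"
    and ex: "\<And>W a b. a \<in> hom C W X \<Longrightarrow> b \<in> hom C W Y \<Longrightarrow> f \<cdot> a = g \<cdot> b \<Longrightarrow>
      \<exists>u. u \<in> hom C W P \<and> p \<cdot> u = a \<and> q \<cdot> u = b"
    and ext: "\<And>W u v. u \<in> hom C W P \<Longrightarrow> v \<in> hom C W P \<Longrightarrow> p \<cdot> u = p \<cdot> v \<Longrightarrow> q \<cdot> u = q \<cdot> v \<Longrightarrow> u = v"
  shows "is_pullback C f g P p q"
proof -
  have "\<exists>!u. u \<in> hom C W P \<and> p \<cdot> u = a \<and> q \<cdot> u = b"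
    if "a \<in> hom C W X" "b \<in> hom C W Y" "f \<cdot> a = g \<cdot> b" for W a b
  proof -
    have "\<exists>u. u \<in> hom C W P \<and> p \<cdot> u = a \<and> q \<cdot> u = b"
      using ex[OF that] .
    then show ?thesis
      using ext[of _ W] by metis
  qed
  then have "\<forall>W. \<forall>a \<in> hom C W X. \<forall>b \<in> hom C W Y. f \<cdot> a = g \<cdot> b \<longrightarrow>
      (\<exists>!u. u \<in> hom C W P \<and> p \<cdot> u = a \<and> q \<cdot> u = b)"
    by blast
  moreover have "Dom C f = X" "Dom C g = Y" "Cod C f = Z" "Cod C g = Z" "f \<in> Arr C" "g \<in> Arr C"
    using assms(3,4) by auto
  ultimately show ?thesis
    using assms(1,2,5) unfolding is_pullback_def by (simp del: hom_iff)
qed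

lemma pullback_sym: "is_pullback C f g P p q \<Longrightarrow> is_pullback C g f P q p"
  unfolding is_pullback_def by (metis hom_iff)

lemma pullback_jointly_monic: "is_pullback C f g P p q \<Longrightarrow> jointly_monic C P p q"
  unfolding jointly_monic_def using pullback_ext by blast

lemma pairing_eq:
  assumes "is_pullback C f g P p q" "u \<in> hom C W P" "p \<cdot> u = a" "q \<cdot> u = b"
  shows "pairing C p q a b = u"
proof -
  note [simp] = pullback_arr[OF assms(1)]
  have "Dom C a = W" using assms(2,3) by auto
  then show ?thesis
    unfolding pairing_def using assms(2-4) pullback_ext[OF assms(1)]
    by (intro the_equality) auto
qed

end

section \<open>Pointed finitely complete categories\<close>

locale pointed_finitely_complete_category = category C for C :: "('o, 'm) precategory" (structure) +
  assumes pointed: "pointed C"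
    and finitely_complete: "finitely_complete C"
begin

lemma pullback_exists:
  assumes f: "f \<in> Arr C" and g: "g \<in> Arr C" and fg: "Cod C f = Cod C g"
  obtains P p q where "is_pullback C f g P p q"
proof -
  \<comment> \<open>The cospan shape: the arrows 0, 1, 2 are identities, 3 goes from 0 to 2 and 4 from 1 to 2.\<close>
  define J :: "(nat, nat) precategory" where
    "J = \<lparr>Obj = {0, 1, 2}, Arr = {0, 1, 2, 3, 4},
          Dom = (\<lambda>a. if a = 3 then 0 else if a = 4 then 1 else a),
          Cod = (\<lambda>a. if a = 3 \<or> a = 4 then 2 else a),
          Id = (\<lambda>i. i), Comp = (\<lambda>b a. if a \<le> 2 then b else a)\<rparr>"
  define Fo :: "nat \<Rightarrow> 'o" where
    "Fo i = (if i = 0 then Dom C f else if i = 1 then Dom C g else Cod C g)" for i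
  define Fa :: "nat \<Rightarrow> 'm" where
    "Fa a = (if a = 3 then f else if a = 4 then g else Id C (Fo a))" for a
  have J: "category J"
    by unfold_locales (auto simp: J_def hom_def split: if_splits)
  have ob [simp]: "Dom C f \<in> Obj C" "Dom C g \<in> Obj C" "Cod C g \<in> Obj C"
    using f g Dom_in_Obj Cod_in_Obj by auto
  have "is_functor J C Fo Fa"
    unfolding is_functor_def using f g fg
    by (auto simp: J_def Fo_def Fa_def hom_def split: if_splits)
  then obtain L pr where lim: "is_limit J C Fo Fa L pr"
    using finitely_complete J unfolding finitely_complete_def by (fastforce simp: J_def)
  have cone_iff: "is_cone J C Fo Fa W r \<longleftrightarrow> r 0 \<in> hom C W (Dom C f) \<and> r 1 \<in> hom C W (Dom C g) \<and>
      f \<cdot> r 0 = g \<cdot> r 1 \<and> r 2 = f \<cdot> r 0" for W r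
    unfolding is_cone_def using f g fg
    by (auto simp: J_def Fo_def Fa_def hom_def Dom_in_Obj all_conj_distrib)
  have 0: "pr 0 \<in> hom C L (Dom C f)" "pr 1 \<in> hom C L (Dom C g)" "f \<cdot> pr 0 = g \<cdot> pr 1"
    "pr 2 = f \<cdot> pr 0"
    using lim cone_iff unfolding is_limit_def by auto
  have "\<exists>!u. u \<in> hom C W L \<and> pr 0 \<cdot> u = a \<and> pr 1 \<cdot> u = b"
    if ab: "a \<in> hom C W (Dom C f)" "b \<in> hom C W (Dom C g)" "f \<cdot> a = g \<cdot> b" for W a b
  proof -
    define r where "r i = (if i = 0 then a else if i = 1 then b else f \<cdot> a)" for i :: nat
    have "is_cone J C Fo Fa W r"
      unfolding cone_iff using ab by (simp add: r_def)
    then have "\<exists>!u. u \<in> hom C W L \<and> (\<forall>i\<in>Obj J. pr i \<cdot> u = r i)"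
      using lim unfolding is_limit_def by blast
    moreover have "u \<in> hom C W L \<and> (\<forall>i\<in>Obj J. pr i \<cdot> u = r i) \<longleftrightarrow>
        u \<in> hom C W L \<and> pr 0 \<cdot> u = a \<and> pr 1 \<cdot> u = b" for u
      using f 0(1,2) by (auto simp: J_def r_def 0(4))
    ultimately show ?thesis by simp
  qed
  then have "is_pullback C f g L (pr 0) (pr 1)"
    using f g fg 0(1-3) unfolding is_pullback_def by blast
  then show thesis by (rule that)
qed

lemma kernel_pair_equivalence_relation:
  assumes pb: "is_pullback C f f R r0 r1"
  obtains \<Delta> where "equivalence_relation C (Dom C f) R r0 r1 \<Delta>"
proof -
  note [simp] = pullback_arr[OF pb]
  have [simp]: "Dom C f \<in> Obj C" by (simp add: Dom_in_Obj)
  note comm = pullback_comm[OF pb]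
  obtain \<Delta> where \<Delta>: "\<Delta> \<in> Arr C" "Dom C \<Delta> = Dom C f" "Cod C \<Delta> = R" "r0 \<cdot> \<Delta> = Id C (Dom C f)"
      "r1 \<cdot> \<Delta> = Id C (Dom C f)"
    by (rule pullback_lift[OF pb, of "Id C (Dom C f)" "Dom C f" "Id C (Dom C f)"]) auto
  obtain \<sigma> where \<sigma>: "\<sigma> \<in> Arr C" "Dom C \<sigma> = R" "Cod C \<sigma> = R" "r0 \<cdot> \<sigma> = r1" "r1 \<cdot> \<sigma> = r0"
    by (rule pullback_lift[OF pb, of r1 R r0]) (auto simp: comm)
  obtain P p q where T: "is_pullback C r1 r0 P p q"
    by (rule pullback_exists[of r1 r0]) auto
  note [simp] = pullback_arr[OF T]
  have "f \<cdot> (r0 \<cdot> p) = f \<cdot> (r1 \<cdot> q)"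
    using comp_reduce[OF comm] pullback_comm[OF T] by (simp add: comm)
  then obtain \<tau> where \<tau>: "\<tau> \<in> Arr C" "Dom C \<tau> = P" "Cod C \<tau> = R" "r0 \<cdot> \<tau> = r0 \<cdot> p" "r1 \<cdot> \<tau> = r1 \<cdot> q"
    by (rule pullback_lift[OF pb, of "r0 \<cdot> p" P "r1 \<cdot> q", rotated 2]) auto
  have "\<exists>\<sigma> \<in> hom C R R. r0 \<cdot> \<sigma> = r1 \<and> r1 \<cdot> \<sigma> = r0"
    by (rule bexI[of _ \<sigma>]) (simp_all add: \<sigma>)
  moreover have "\<exists>\<tau> \<in> hom C P R. r0 \<cdot> \<tau> = r0 \<cdot> p \<and> r1 \<cdot> \<tau> = r1 \<cdot> q"
    by (rule bexI[of _ \<tau>]) (simp_all add: \<tau>)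
  ultimately have "equivalence_relation C (Dom C f) R r0 r1 \<Delta>"
    unfolding equivalence_relation_def
    using T pullback_jointly_monic[OF pb] by (simp add: \<Delta>) blast
  then show thesis by (rule that)
qed

subsection \<open>Zero arrows and kernels\<close>

lemma zero_object: obtains Z where "is_zero_object C Z"
  using pointed unfolding pointed_def by blast

lemma zero_object_unique:
  assumes "is_zero_object C Z"
  shows "u \<in> hom C W Z \<Longrightarrow> v \<in> hom C W Z \<Longrightarrow> u = v"
    and "u \<in> hom C Z W \<Longrightarrow> v \<in> hom C Z W \<Longrightarrow> u = v"
  using assms Obj_if_arr[of u] unfolding is_zero_object_def by (metis hom_iff)+

lemma zero_arr_eq:
  assumes Z: "is_zero_object C Z" and u: "u \<in> hom C X Z" and v: "v \<in> hom C Z Y"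
  shows "zero_arr C X Y = v \<cdot> u"
  unfolding zero_arr_def
proof (rule the_equality)
  show "\<exists>Z u' v'. is_zero_object C Z \<and> u' \<in> hom C X Z \<and> v' \<in> hom C Z Y \<and> v \<cdot> u = v' \<cdot> u'"
    using assms by blast
next
  fix z
  assume "\<exists>Z u v. is_zero_object C Z \<and> u \<in> hom C X Z \<and> v \<in> hom C Z Y \<and> z = v \<cdot> u"
  then obtain Z' u' v' where Z': "is_zero_object C Z'" "u' \<in> hom C X Z'" "v' \<in> hom C Z' Y" "z = v' \<cdot> u'"
    by blast
  have XY: "X \<in> Obj C" "Y \<in> Obj C" "Z' \<in> Obj C" "Z \<in> Obj C"
    using Z' Obj_if_arr(1)[of u'] Obj_if_arr(2)[of v'] Z by (auto simp: is_zero_object_def)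
  obtain w where w: "w \<in> hom C Z Z'"
    using Z XY unfolding is_zero_object_def by blast
  have "w \<cdot> u \<in> hom C X Z'" "v' \<cdot> w \<in> hom C Z Y"
    using w u Z'(3) by auto
  then have "u' = w \<cdot> u" "v' \<cdot> w = v"
    using zero_object_unique(1)[OF Z'(1) Z'(2)] zero_object_unique(2)[OF Z _ v] by blast+
  then show "z = v \<cdot> u"
    using Z' w u by auto
qed

lemma zero_arr_factor:
  assumes "X \<in> Obj C" "Y \<in> Obj C"
  obtains Z u v where "is_zero_object C Z" "u \<in> hom C X Z" "v \<in> hom C Z Y" "zero_arr C X Y = v \<cdot> u"
proof -
  obtain Z where Z: "is_zero_object C Z" by (rule zero_object)
  obtain u where u: "u \<in> hom C X Z"
    using Z assms(1) unfolding is_zero_object_def by blast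
  obtain v where v: "v \<in> hom C Z Y"
    using Z assms(2) unfolding is_zero_object_def by blast
  note uv = u v
  show thesis by (rule that[OF Z uv zero_arr_eq[OF Z uv]])
qed

lemma zero_arr [simp]:
  assumes "X \<in> Obj C" "Y \<in> Obj C"
  shows "zero_arr C X Y \<in> Arr C" "Dom C (zero_arr C X Y) = X" "Cod C (zero_arr C X Y) = Y"
  by (rule zero_arr_factor[OF assms]; auto)+

lemma comp_zero [simp]:
  assumes "f \<in> Arr C" "Dom C f = Y" "W \<in> Obj C"
  shows "f \<cdot> zero_arr C W Y = zero_arr C W (Cod C f)"
proof -
  have "Y \<in> Obj C" using assms Dom_in_Obj by auto
  then obtain Z u v where Z: "is_zero_object C Z" "u \<in> hom C W Z" "v \<in> hom C Z Y" "zero_arr C W Y = v \<cdot> u"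
    by (rule zero_arr_factor[OF assms(3)])
  then have "zero_arr C W (Cod C f) = (f \<cdot> v) \<cdot> u"
    using assms by (intro zero_arr_eq[OF Z(1)]) auto
  then show ?thesis using Z assms by auto
qed

lemma zero_comp [simp]:
  assumes "f \<in> Arr C" "Cod C f = X" "Y \<in> Obj C"
  shows "zero_arr C X Y \<cdot> f = zero_arr C (Dom C f) Y"
proof -
  have "X \<in> Obj C" using assms Cod_in_Obj by auto
  then obtain Z u v where Z: "is_zero_object C Z" "u \<in> hom C X Z" "v \<in> hom C Z Y" "zero_arr C X Y = v \<cdot> u"
    by (rule zero_arr_factor[OF _ assms(3)])
  then have "zero_arr C (Dom C f) Y = v \<cdot> (u \<cdot> f)"
    using assms by (intro zero_arr_eq[OF Z(1)]) auto
  then show ?thesis using Z assms by auto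
qed

lemma kernel_arr:
  assumes "is_kernel C f K k"
  shows "f \<in> Arr C" "k \<in> Arr C" "Dom C k = K" "Cod C k = Dom C f" "K \<in> Obj C"
    "f \<cdot> k = zero_arr C K (Cod C f)"
  using assms Dom_in_Obj unfolding is_kernel_def by auto

lemma kernel_lift:
  assumes "is_kernel C f K k" "a \<in> hom C W (Dom C f)" "f \<cdot> a = zero_arr C W (Cod C f)"
  obtains u where "u \<in> Arr C" "Dom C u = W" "Cod C u = K" "k \<cdot> u = a"
  using assms unfolding is_kernel_def by (metis hom_iff)

lemma kernel_ext:
  assumes "is_kernel C f K k" "u \<in> hom C W K" "v \<in> hom C W K" "k \<cdot> u = k \<cdot> v"
  shows "u = v"
proof -
  note [simp] = kernel_arr[OF assms(1)]
  have "f \<cdot> (k \<cdot> v) = zero_arr C W (Cod C f)"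
    using assms(3) comp_reduce[OF kernel_arr(6)[OF assms(1)]] by (simp add: Cod_in_Obj)
  then have "\<exists>!u. u \<in> hom C W K \<and> k \<cdot> u = k \<cdot> v"
    using assms(1,3) unfolding is_kernel_def by auto
  then show ?thesis using assms by blast
qed

lemma kernelI:
  assumes f: "f \<in> hom C A B" "k \<in> hom C K A" "f \<cdot> k = zero_arr C K B"
    and ex: "\<And>W a. a \<in> hom C W A \<Longrightarrow> f \<cdot> a = zero_arr C W B \<Longrightarrow> \<exists>u. u \<in> hom C W K \<and> k \<cdot> u = a"
    and ext: "\<And>W u v. u \<in> hom C W K \<Longrightarrow> v \<in> hom C W K \<Longrightarrow> k \<cdot> u = k \<cdot> v \<Longrightarrow> u = v"
  shows "is_kernel C f K k"
proof -
  have "\<exists>!u. u \<in> hom C W K \<and> k \<cdot> u = a" if "a \<in> hom C W A" "f \<cdot> a = zero_arr C W B" for W a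
    using ex[OF that] ext by metis
  then have "\<forall>W. \<forall>a \<in> hom C W A. f \<cdot> a = zero_arr C W B \<longrightarrow> (\<exists>!u. u \<in> hom C W K \<and> k \<cdot> u = a)"
    by blast
  moreover have "f \<in> Arr C" "Dom C f = A" "Cod C f = B"
    using f(1) by auto
  ultimately show ?thesis
    using f(2,3) unfolding is_kernel_def by (simp del: hom_iff)
qed

text \<open>Pulling back does not change the kernel: where the second coordinate vanishes, the first one lies
  in the kernel of \<open>f\<close>.\<close>

lemma pullback_kernel:
  assumes pb: "is_pullback C f g P p q" and ker: "is_kernel C f K k"
    and i: "i \<in> hom C K P" "p \<cdot> i = k" "q \<cdot> i = zero_arr C K (Dom C g)"
  shows "is_kernel C q K i"
proof -
  note [simp] = pullback_arr[OF pb] kernel_arr[OF ker] i(2,3) i(1)[unfolded hom_iff]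
  show ?thesis
  proof (rule kernelI[of _ P "Dom C g"])
    fix W a assume a: "a \<in> hom C W P" "q \<cdot> a = zero_arr C W (Dom C g)"
    then have [simp]: "a \<in> Arr C" "Dom C a = W" "Cod C a = P" "W \<in> Obj C"
      using Dom_in_Obj by auto
    have "f \<cdot> (p \<cdot> a) = zero_arr C W (Cod C f)"
      using comp_reduce[OF pullback_comm[OF pb]] a by simp
    then obtain u where [simp]: "u \<in> Arr C" "Dom C u = W" "Cod C u = K" and u: "k \<cdot> u = p \<cdot> a"
      by (rule kernel_lift[OF ker, rotated]) auto
    have "i \<cdot> u = a"
      by (rule pullback_ext[OF pb, of _ W])
        (use a u in \<open>auto simp: comp_reduce[OF i(2)] comp_reduce[OF i(3)] Dom_in_Obj\<close>)
    then show "\<exists>u. u \<in> hom C W K \<and> i \<cdot> u = a" by (intro exI[of _ u]) simp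
  next
    fix W u v assume uv: "u \<in> hom C W K" "v \<in> hom C W K" "i \<cdot> u = i \<cdot> v"
    then have "k \<cdot> u = k \<cdot> v"
      using comp_reduce[OF i(2), of u] comp_reduce[OF i(2), of v] by auto
    then show "u = v" using kernel_ext[OF ker uv(1,2)] by auto
  qed auto
qed

lemma kernel_exists:
  assumes f: "f \<in> hom C A B"
  obtains K k where "is_kernel C f K k"
proof -
  have [simp]: "f \<in> Arr C" "Dom C f = A" "Cod C f = B" "A \<in> Obj C" "B \<in> Obj C"
    using f Dom_in_Obj Cod_in_Obj by auto
  obtain Z where Z: "is_zero_object C Z" by (rule zero_object)
  then have [simp]: "Z \<in> Obj C" by (simp add: is_zero_object_def)
  note Zu = zero_object_unique(1)[OF Z]
  obtain K k t where pb: "is_pullback C f (zero_arr C Z B) K k t"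
    by (rule pullback_exists[of f "zero_arr C Z B"]) auto
  note [simp] = pullback_arr[OF pb]
  have "is_kernel C f K k"
  proof (rule kernelI[of _ A B])
    show "f \<cdot> k = zero_arr C K B"
      using pullback_comm[OF pb] by simp
  next
    fix W a assume a: "a \<in> hom C W A" "f \<cdot> a = zero_arr C W B"
    then have [simp]: "W \<in> Obj C" using Dom_in_Obj by auto
    obtain u where "u \<in> Arr C" "Dom C u = W" "Cod C u = K" "k \<cdot> u = a"
      by (rule pullback_lift[OF pb, of a W "zero_arr C W Z"]) (use a in auto)
    then show "\<exists>u. u \<in> hom C W K \<and> k \<cdot> u = a" by auto
  next
    fix W u v assume uv: "u \<in> hom C W K" "v \<in> hom C W K" "k \<cdot> u = k \<cdot> v"
    show "u = v"
      by (rule pullback_ext[OF pb uv]) (rule Zu[of _ W]; use uv in simp)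
  qed auto
  then show thesis by (rule that)
qed

lemma kernel_pair_of_arrow:
  assumes f: "f \<in> hom C A B" and K: "is_kernel C f K k"
  obtains R r0 r1 \<Delta> where "is_pullback C f f R r0 r1" "equivalence_relation C A R r0 r1 \<Delta>"
    "is_normalisation C r0 r1 k"
proof -
  note [simp] = kernel_arr(2,3,5)[OF K] f[unfolded hom_iff]
  have [simp]: "A \<in> Obj C" "B \<in> Obj C" using Obj_if_arr[of f] by auto
  have [simp]: "Cod C k = A" using kernel_arr(4)[OF K] by simp
  have fk: "f \<cdot> k = zero_arr C K B" using kernel_arr(6)[OF K] by simp
  obtain R r0 r1 where R: "is_pullback C f f R r0 r1"
    by (rule pullback_exists[of f f]) auto
  obtain \<Delta> where "equivalence_relation C (Dom C f) R r0 r1 \<Delta>"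
    by (rule kernel_pair_equivalence_relation[OF R])
  then have eq: "equivalence_relation C A R r0 r1 \<Delta>" by simp
  obtain w where w: "w \<in> Arr C" "Dom C w = K" "Cod C w = R" "r0 \<cdot> w = zero_arr C K A" "r1 \<cdot> w = k"
    by (rule pullback_lift[OF R, of "zero_arr C K A" K k]) (auto simp: fk)
  have "is_kernel C r0 K w"
    by (rule pullback_kernel[OF pullback_sym[OF R] K]) (use w in auto)
  then have "is_normalisation C r0 r1 k"
    unfolding is_normalisation_def using w(5) by blast
  then show thesis by (rule that[OF R eq])
qed

subsection \<open>Products\<close>

text \<open>Lets products inherit existence and the description of kernels of projections from pullbacks.\<close>

lemma product_is_pullback:
  assumes Z: "is_zero_object C Z" and [simp]: "X \<in> Obj C" "Y \<in> Obj C"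
  shows "is_product C X Y P p q \<longleftrightarrow> is_pullback C (zero_arr C X Z) (zero_arr C Y Z) P p q"
proof -
  have [simp]: "Z \<in> Obj C" using Z by (simp add: is_zero_object_def)
  show ?thesis
    unfolding is_product_def is_pullback_def by (auto simp: Dom_in_Obj)
qed

lemma product_exists:
  assumes [simp]: "X \<in> Obj C" "Y \<in> Obj C"
  obtains P p q where "is_product C X Y P p q"
proof -
  obtain Z where Z: "is_zero_object C Z" by (rule zero_object)
  then have [simp]: "Z \<in> Obj C" by (simp add: is_zero_object_def)
  show thesis
    by (rule pullback_exists[of "zero_arr C X Z" "zero_arr C Y Z"])
      (auto intro: that simp: product_is_pullback[OF Z])
qed

lemma product_arr:
  assumes "is_product C X Y P p q"
  shows "p \<in> Arr C" "q \<in> Arr C" "Dom C p = P" "Cod C p = X" "Dom C q = P" "Cod C q = Y"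
    "P \<in> Obj C" "X \<in> Obj C" "Y \<in> Obj C"
  using assms Dom_in_Obj Cod_in_Obj unfolding is_product_def by auto

lemma product_lift:
  assumes "is_product C X Y P p q" "a \<in> hom C W X" "b \<in> hom C W Y"
  obtains u where "u \<in> Arr C" "Dom C u = W" "Cod C u = P" "p \<cdot> u = a" "q \<cdot> u = b"
  using assms unfolding is_product_def by (metis hom_iff)

lemma product_ext:
  assumes "is_product C X Y P p q" "u \<in> hom C W P" "v \<in> hom C W P" "p \<cdot> u = p \<cdot> v" "q \<cdot> u = q \<cdot> v"
  shows "u = v"
proof -
  note [simp] = product_arr[OF assms(1)]
  have "\<exists>!u. u \<in> hom C W P \<and> p \<cdot> u = p \<cdot> v \<and> q \<cdot> u = q \<cdot> v"
    using assms(1,3) unfolding is_product_def by auto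
  then show ?thesis using assms by blast
qed

lemma product_pairing_eq:
  assumes "is_product C X Y P p q" "u \<in> hom C W P" "p \<cdot> u = a" "q \<cdot> u = b"
  shows "pairing C p q a b = u"
proof -
  obtain Z where Z: "is_zero_object C Z" by (rule zero_object)
  show ?thesis
    using pairing_eq[of _ _ P p q u W] assms product_is_pullback[OF Z] product_arr[OF assms(1)] by blast
qed

lemma product_sym: "is_product C X Y P p q \<Longrightarrow> is_product C Y X P q p"
  unfolding is_product_def by (metis hom_iff)

lemma product_kernel:
  assumes prod: "is_product C X Y P p q"
    and i: "i \<in> hom C X P" "p \<cdot> i = Id C X" "q \<cdot> i = zero_arr C X Y"
  shows "is_kernel C q X i"
proof -
  note [simp] = product_arr[OF prod]
  obtain Z where Z: "is_zero_object C Z" by (rule zero_object)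
  then have [simp]: "Z \<in> Obj C" by (simp add: is_zero_object_def)
  have "is_kernel C (zero_arr C X Z) X (Id C X)"
    by (rule kernelI[of _ X Z]) auto
  then show ?thesis
    using pullback_kernel[of "zero_arr C X Z" "zero_arr C Y Z" P p q X "Id C X" i]
      prod product_is_pullback[OF Z] i by auto
qed

end

section \<open>Protomodular categories\<close>

locale protomodular_category = pointed_finitely_complete_category C
  for C :: "('o, 'm) precategory" (structure) +
  assumes split_short_five: "split_short_five_lemma C"
begin

lemma split_epiD:
  assumes "split_epi C A B f s"
  shows "f \<in> Arr C" "Dom C f = A" "Cod C f = B" "s \<in> Arr C" "Dom C s = B" "Cod C s = A"
    "f \<cdot> s = Id C B" "A \<in> Obj C" "B \<in> Obj C"
  using assms Dom_in_Obj Cod_in_Obj unfolding split_epi_def by auto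

lemma iso_if_iso_on_base_and_kernel:
  assumes f: "split_epi C A B f s" "is_kernel C f K i"
    and f': "split_epi C A' B' f' s'" "is_kernel C f' K (a \<cdot> i)"
    and a: "a \<in> hom C A A'" and b: "b \<in> hom C B B'" "is_iso C b"
    and eq: "b \<cdot> f = f' \<cdot> a" "s' \<cdot> b = a \<cdot> s"
  shows "is_iso C a"
proof -
  note [simp] = kernel_arr(1-5)[OF f(2)] kernel_arr(1-5)[OF f'(2)]
  have "a \<cdot> i = (a \<cdot> i) \<cdot> Id C K" by simp
  moreover have "Id C K \<in> hom C K K" "is_iso C (Id C K)" by (simp_all add: iso_Id)
  ultimately show ?thesis
    using split_short_five assms unfolding split_short_five_lemma_def by metis
qed

text \<open>The kernel of \<open>f\<close> factors through \<open>m\<close>, so it is also the kernel of \<open>f m\<close>, which is split by \<open>s'\<close>;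
  the Split Short Five Lemma compares \<open>f m\<close> with \<open>f\<close>.\<close>

lemma iso_if_monic_and_lifts:
  assumes f: "split_epi C A B f s" "is_kernel C f K i"
    and m: "monic m" "m \<in> hom C M A"
    and i': "i' \<in> hom C K M" "m \<cdot> i' = i" and s': "s' \<in> hom C B M" "m \<cdot> s' = s"
  shows "is_iso C m"
proof (rule iso_if_iso_on_base_and_kernel[where f = "f \<cdot> m" and s = s' and i = i' and b = "Id C B"])
  note [simp] = split_epiD[OF f(1)] kernel_arr(1-5)[OF f(2)] m(2)[unfolded hom_iff]
    i'(1)[unfolded hom_iff] s'(1)[unfolded hom_iff]
  show "split_epi C M B (f \<cdot> m) s'"
    unfolding split_epi_def by (simp add: s'(2))
  show "is_kernel C (f \<cdot> m) K i'"
  proof (rule kernelI[of _ M B])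
    show "(f \<cdot> m) \<cdot> i' = zero_arr C K B"
      using kernel_arr(6)[OF f(2)] by (simp add: i'(2))
  next
    fix W a assume a: "a \<in> hom C W M" "(f \<cdot> m) \<cdot> a = zero_arr C W B"
    obtain u where u: "u \<in> Arr C" "Dom C u = W" "Cod C u = K" "i \<cdot> u = m \<cdot> a"
      by (rule kernel_lift[OF f(2), of "m \<cdot> a" W]) (use a in auto)
    have "m \<cdot> (i' \<cdot> u) = m \<cdot> a"
      using comp_reduce[OF i'(2), of u] u by simp
    then have "i' \<cdot> u = a"
      using monicD[OF m(1), of "i' \<cdot> u" W a] u a by simp
    then show "\<exists>u. u \<in> hom C W K \<and> i' \<cdot> u = a" using u by (intro exI[of _ u]) simp
  next
    fix W u v assume uv: "u \<in> hom C W K" "v \<in> hom C W K" "i' \<cdot> u = i' \<cdot> v"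
    then have "i \<cdot> u = i \<cdot> v"
      using comp_reduce[OF i'(2), of u] comp_reduce[OF i'(2), of v] by simp
    then show "u = v" by (rule kernel_ext[OF f(2) uv(1,2)])
  qed auto
  show "split_epi C A B f s" "is_kernel C f K (m \<cdot> i')" "m \<in> hom C M A" "is_iso C (Id C B)"
    using f m i' by (simp_all add: iso_Id)
  show "Id C B \<cdot> (f \<cdot> m) = f \<cdot> m" "s \<cdot> Id C B = m \<cdot> s'"
    by (simp_all add: s'(2))
qed (use split_epiD[OF f(1)] in auto)

text \<open>The elements \<open>a\<close> of \<open>A\<close> with \<open>u a\<close> related to \<open>v a\<close> form a subobject, which contains the kernel and
  the section and is therefore all of \<open>A\<close>.\<close>

lemma relation_lift:
  assumes f: "split_epi C A B f s" "is_kernel C f K i"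
    and r: "r0 \<in> hom C R X" "r1 \<in> hom C R Y" "jointly_monic C R r0 r1"
    and u: "u \<in> hom C A X" and v: "v \<in> hom C A Y"
    and a: "a \<in> hom C K R" "r0 \<cdot> a = u \<cdot> i" "r1 \<cdot> a = v \<cdot> i"
    and b: "b \<in> hom C B R" "r0 \<cdot> b = u \<cdot> s" "r1 \<cdot> b = v \<cdot> s"
  obtains w where "w \<in> Arr C" "Dom C w = A" "Cod C w = R" "r0 \<cdot> w = u" "r1 \<cdot> w = v"
proof -
  note [simp] = split_epiD[OF f(1)] kernel_arr(1-5)[OF f(2)] r(1,2)[unfolded hom_iff]
    u[unfolded hom_iff] v[unfolded hom_iff] a(1)[unfolded hom_iff] b(1)[unfolded hom_iff]
  have [simp]: "X \<in> Obj C" "Y \<in> Obj C" "R \<in> Obj C"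
    using Obj_if_arr[of r0] Obj_if_arr[of r1] by auto
  obtain Q p q where Q: "is_product C X Y Q p q"
    by (rule product_exists[of X Y]) auto
  note [simp] = product_arr[OF Q]
  obtain uv where [simp]: "uv \<in> Arr C" "Dom C uv = A" "Cod C uv = Q" and uv: "p \<cdot> uv = u" "q \<cdot> uv = v"
    by (rule product_lift[OF Q, of u A v]) auto
  obtain rr where [simp]: "rr \<in> Arr C" "Dom C rr = R" "Cod C rr = Q" and rr: "p \<cdot> rr = r0" "q \<cdot> rr = r1"
    by (rule product_lift[OF Q, of r0 R r1]) auto
  note uv' = comp_reduce[OF uv(1)] comp_reduce[OF uv(2)] and rr' = comp_reduce[OF rr(1)] comp_reduce[OF rr(2)]
  \<comment> \<open>\<open>M\<close> is the subobject of the \<open>a\<close> with \<open>u a\<close> related to \<open>v a\<close>.\<close>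
  obtain M m n where M: "is_pullback C uv rr M m n"
    by (rule pullback_exists[of uv rr]) auto
  note [simp] = pullback_arr[OF M]
  have eq: "r0 \<cdot> n = u \<cdot> m" "r1 \<cdot> n = v \<cdot> m"
    using pullback_comm[OF M] uv'(1)[of m] uv'(2)[of m] rr'(1)[of n] rr'(2)[of n] by auto
  note eq' = comp_reduce[OF eq(1)] comp_reduce[OF eq(2)]
  have "monic m"
    unfolding monic_def
  proof (intro conjI allI ballI impI)
    fix W a b assume ab: "a \<in> hom C W (Dom C m)" "b \<in> hom C W (Dom C m)" "m \<cdot> a = m \<cdot> b"
    have "n \<cdot> a = n \<cdot> b"
      by (rule jointly_monicD[OF r(3), of _ W]) (use ab eq' in auto)
    then show "a = b"
      using pullback_ext[OF M, of a W b] ab by auto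
  qed auto
  have "uv \<cdot> i = rr \<cdot> a" "uv \<cdot> s = rr \<cdot> b"
    by (rule product_ext[OF Q, of _ K] product_ext[OF Q, of _ B]; simp add: uv' rr' a b)+
  obtain i' where i': "i' \<in> Arr C" "Dom C i' = K" "Cod C i' = M" "m \<cdot> i' = i" "n \<cdot> i' = a"
    by (rule pullback_lift[OF M, of i K a]) (use \<open>uv \<cdot> i = rr \<cdot> a\<close> in auto)
  obtain s' where s': "s' \<in> Arr C" "Dom C s' = B" "Cod C s' = M" "m \<cdot> s' = s" "n \<cdot> s' = b"
    by (rule pullback_lift[OF M, of s B b]) (use \<open>uv \<cdot> s = rr \<cdot> b\<close> in auto)
  have "is_iso C m"
    by (rule iso_if_monic_and_lifts[OF f \<open>monic m\<close>, of M i' s']) (use i' s' in auto)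
  then obtain g where [simp]: "g \<in> Arr C" "Dom C g = A" "Cod C g = M" and g: "m \<cdot> g = Id C A"
    by (rule is_isoE[of m M A]) auto
  show thesis
    by (rule that[of "n \<cdot> g"]) (auto simp: eq' g)
qed

text \<open>Two arrows agree wherever they are related by the identity relation.\<close>

lemma jointly_epic:
  assumes f: "split_epi C A B f s" "is_kernel C f K i"
    and u: "u \<in> hom C A X" and v: "v \<in> hom C A X"
    and eq: "u \<cdot> i = v \<cdot> i" "u \<cdot> s = v \<cdot> s"
  shows "u = v"
proof -
  note [simp] = split_epiD[OF f(1)] kernel_arr(1-5)[OF f(2)] u[unfolded hom_iff] v[unfolded hom_iff]
  have [simp]: "X \<in> Obj C" using Obj_if_arr[of u] by auto
  obtain w where "w \<in> Arr C" "Dom C w = A" "Cod C w = X" "Id C X \<cdot> w = u" "Id C X \<cdot> w = v"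
    by (rule relation_lift[OF f, of "Id C X" X X "Id C X" X u v "u \<cdot> i" "u \<cdot> s"])
      (auto simp: jointly_monic_def eq)
  then show ?thesis by simp
qed

text \<open>The projections of the kernel pair agree on the diagonal and, as the kernel is trivial, on the
  kernel of the first projection; so they are equal.\<close>

lemma monic_if_trivial_kernel:
  assumes m: "m \<in> hom C A B"
    and ker: "\<And>W a. a \<in> hom C W A \<Longrightarrow> m \<cdot> a = zero_arr C W B \<Longrightarrow> a = zero_arr C W A"
  shows "monic m"
proof -
  have [simp]: "m \<in> Arr C" "Dom C m = A" "Cod C m = B" "A \<in> Obj C" "B \<in> Obj C"
    using m Dom_in_Obj Cod_in_Obj by auto
  obtain R r0 r1 where R: "is_pullback C m m R r0 r1"
    by (rule pullback_exists[of m m]) auto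
  note [simp] = pullback_arr[OF R]
  obtain \<Delta> where [simp]: "\<Delta> \<in> Arr C" "Dom C \<Delta> = A" "Cod C \<Delta> = R" and \<Delta>: "r0 \<cdot> \<Delta> = Id C A" "r1 \<cdot> \<Delta> = Id C A"
    by (rule pullback_lift[OF R, of "Id C A" A "Id C A"]) auto
  obtain K i where K: "is_kernel C r0 K i"
    by (rule kernel_exists[of r0 R A]) auto
  note [simp] = kernel_arr[OF K]
  have "m \<cdot> (r1 \<cdot> i) = zero_arr C K B"
    using comp_reduce[OF pullback_comm[OF R], of i] by simp
  then have "r1 \<cdot> i = zero_arr C K A"
    by (intro ker) auto
  moreover have "r0 \<cdot> i = zero_arr C K A"
    using kernel_arr(6)[OF K] by simp
  moreover have sp: "split_epi C R A r0 \<Delta>" by (simp add: split_epi_def \<Delta>)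
  ultimately have "r0 = r1"
    using \<Delta> by (auto intro: jointly_epic[OF sp K, of r0 A r1])
  show ?thesis
    unfolding monic_def
  proof (intro conjI allI ballI impI)
    fix W a b assume ab: "a \<in> hom C W (Dom C m)" "b \<in> hom C W (Dom C m)" "m \<cdot> a = m \<cdot> b"
    then obtain u where "r0 \<cdot> u = a" "r1 \<cdot> u = b"
      by (rule pullback_lift[OF R])
    then show "a = b" using \<open>r0 = r1\<close> by simp
  qed auto
qed

section \<open>Commuting arrows and commuting relations\<close>

text \<open>In this and the following introduction and elimination rules the pairings of the definitions
  are replaced by arrows given by their components.\<close>

lemma huq_commuteI:
  assumes P: "is_product C X Y P p q" and \<phi>: "\<phi> \<in> hom C P A"
    and i: "i \<in> hom C X P" "p \<cdot> i = Id C X" "q \<cdot> i = zero_arr C X Y" "\<phi> \<cdot> i = k"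
    and j: "j \<in> hom C Y P" "p \<cdot> j = zero_arr C Y X" "q \<cdot> j = Id C Y" "\<phi> \<cdot> j = l"
  shows "huq_commute C A k l"
proof -
  have "pairing C p q (Id C X) (zero_arr C X Y) = i" "pairing C p q (zero_arr C Y X) (Id C Y) = j"
    using product_pairing_eq[OF P] i j by blast+
  moreover have "k \<in> hom C X A" "l \<in> hom C Y A"
    using \<phi> i j by auto
  ultimately show ?thesis
    unfolding huq_commute_def using P \<phi> i j by blast
qed

lemma huq_commuteE:
  assumes "huq_commute C A k l" "k \<in> hom C X A" "l \<in> hom C Y A"
  obtains P p q \<phi> i j where "is_product C X Y P p q" "\<phi> \<in> hom C P A"
    "i \<in> hom C X P" "p \<cdot> i = Id C X" "q \<cdot> i = zero_arr C X Y" "\<phi> \<cdot> i = k"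
    "j \<in> hom C Y P" "p \<cdot> j = zero_arr C Y X" "q \<cdot> j = Id C Y" "\<phi> \<cdot> j = l"
proof -
  obtain X' Y' P p q \<phi> where 0: "k \<in> hom C X' A" "l \<in> hom C Y' A" and P: "is_product C X' Y' P p q" and \<phi>: "\<phi> \<in> hom C P A"
      "\<phi> \<cdot> pairing C p q (Id C X') (zero_arr C X' Y') = k"
      "\<phi> \<cdot> pairing C p q (zero_arr C Y' X') (Id C Y') = l"
    using assms(1) unfolding huq_commute_def by blast
  have [simp]: "X' = X" "Y' = Y" using 0 assms by auto
  note P = P[simplified] and \<phi> = \<phi>[simplified]
  note [simp] = product_arr[OF P]
  obtain i where i: "i \<in> Arr C" "Dom C i = X" "Cod C i = P" "p \<cdot> i = Id C X" "q \<cdot> i = zero_arr C X Y"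
    by (rule product_lift[OF P, of "Id C X" X "zero_arr C X Y"]) auto
  obtain j where j: "j \<in> Arr C" "Dom C j = Y" "Cod C j = P" "p \<cdot> j = zero_arr C Y X" "q \<cdot> j = Id C Y"
    by (rule product_lift[OF P, of "zero_arr C Y X" Y "Id C Y"]) auto
  have "pairing C p q (Id C X) (zero_arr C X Y) = i" "pairing C p q (zero_arr C Y X) (Id C Y) = j"
    using product_pairing_eq[OF P] i j by simp_all
  with \<phi> i j show thesis by (intro that[OF P]) auto
qed

lemma equivalence_relationD:
  assumes "equivalence_relation C A R r0 r1 \<Delta>"
  shows "r0 \<in> Arr C" "Dom C r0 = R" "Cod C r0 = A" "r1 \<in> Arr C" "Dom C r1 = R" "Cod C r1 = A"
    "\<Delta> \<in> Arr C" "Dom C \<Delta> = A" "Cod C \<Delta> = R" "r0 \<cdot> \<Delta> = Id C A" "r1 \<cdot> \<Delta> = Id C A"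
    "jointly_monic C R r0 r1" "A \<in> Obj C" "R \<in> Obj C"
  using assms Dom_in_Obj Cod_in_Obj unfolding equivalence_relation_def by auto

lemma equivalence_relation_sym:
  assumes E: "equivalence_relation C A R r0 r1 \<Delta>" and a: "a \<in> hom C W R"
  obtains b where "b \<in> Arr C" "Dom C b = W" "Cod C b = R" "r0 \<cdot> b = r1 \<cdot> a" "r1 \<cdot> b = r0 \<cdot> a"
proof -
  note [simp] = equivalence_relationD(1-9,13,14)[OF E]
  obtain \<sigma> where \<sigma>: "\<sigma> \<in> hom C R R" "r0 \<cdot> \<sigma> = r1" "r1 \<cdot> \<sigma> = r0"
    using E unfolding equivalence_relation_def by blast
  show thesis
    by (rule that[of "\<sigma> \<cdot> a"]) (use \<sigma>(1) a comp_reduce[OF \<sigma>(2)] comp_reduce[OF \<sigma>(3)] in auto)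
qed

lemma equivalence_relation_trans:
  assumes E: "equivalence_relation C A R r0 r1 \<Delta>" and a: "a \<in> hom C W R" and b: "b \<in> hom C W R"
    and ab: "r1 \<cdot> a = r0 \<cdot> b"
  obtains c where "c \<in> Arr C" "Dom C c = W" "Cod C c = R" "r0 \<cdot> c = r0 \<cdot> a" "r1 \<cdot> c = r1 \<cdot> b"
proof -
  note [simp] = equivalence_relationD(1-9,13,14)[OF E]
  obtain P p q \<tau> where P: "is_pullback C r1 r0 P p q"
      and \<tau>: "\<tau> \<in> hom C P R" "r0 \<cdot> \<tau> = r0 \<cdot> p" "r1 \<cdot> \<tau> = r1 \<cdot> q"
    using E unfolding equivalence_relation_def by blast
  note [simp] = pullback_arr[OF P]
  obtain u where "u \<in> Arr C" "Dom C u = W" "Cod C u = P" "p \<cdot> u = a" "q \<cdot> u = b"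
    by (rule pullback_lift[OF P, of a W b]) (use a b ab in auto)
  then show thesis
    using that[of "\<tau> \<cdot> u"] \<tau>(1) comp_reduce[OF \<tau>(2), of u] comp_reduce[OF \<tau>(3), of u] by auto
qed

lemma smith_commuteI:
  assumes R: "equivalence_relation C A R r0 r1 \<Delta>R" and S: "equivalence_relation C A S s0 s1 \<Delta>S"
    and P: "is_pullback C r1 s0 P p q" and \<theta>: "\<theta> \<in> hom C P A"
    and i: "i \<in> hom C R P" "p \<cdot> i = Id C R" "q \<cdot> i = \<Delta>S \<cdot> r1" "\<theta> \<cdot> i = r0"
    and j: "j \<in> hom C S P" "p \<cdot> j = \<Delta>R \<cdot> s0" "q \<cdot> j = Id C S" "\<theta> \<cdot> j = s1"
  shows "smith_commute C A R r0 r1 \<Delta>R S s0 s1 \<Delta>S"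
proof -
  have "pairing C p q (Id C R) (\<Delta>S \<cdot> r1) = i" "pairing C p q (\<Delta>R \<cdot> s0) (Id C S) = j"
    using pairing_eq[OF P] i j by blast+
  then show ?thesis
    unfolding smith_commute_def using P \<theta> i j by blast
qed

lemma smith_commuteE:
  assumes R: "equivalence_relation C A R r0 r1 \<Delta>R" and S: "equivalence_relation C A S s0 s1 \<Delta>S"
    and RS: "smith_commute C A R r0 r1 \<Delta>R S s0 s1 \<Delta>S"
  obtains P p q \<theta> i j where "is_pullback C r1 s0 P p q" "\<theta> \<in> hom C P A"
    "i \<in> hom C R P" "p \<cdot> i = Id C R" "q \<cdot> i = \<Delta>S \<cdot> r1" "\<theta> \<cdot> i = r0"
    "j \<in> hom C S P" "p \<cdot> j = \<Delta>R \<cdot> s0" "q \<cdot> j = Id C S" "\<theta> \<cdot> j = s1"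
proof -
  note [simp] = equivalence_relationD[OF R] equivalence_relationD[OF S]
  obtain P p q \<theta> where P: "is_pullback C r1 s0 P p q" and \<theta>: "\<theta> \<in> hom C P A"
      "\<theta> \<cdot> pairing C p q (Id C R) (\<Delta>S \<cdot> r1) = r0" "\<theta> \<cdot> pairing C p q (\<Delta>R \<cdot> s0) (Id C S) = s1"
    using RS unfolding smith_commute_def by blast
  note [simp] = pullback_arr[OF P]
  obtain i where i: "i \<in> Arr C" "Dom C i = R" "Cod C i = P" "p \<cdot> i = Id C R" "q \<cdot> i = \<Delta>S \<cdot> r1"
    by (rule pullback_lift[OF P, of "Id C R" R "\<Delta>S \<cdot> r1"])
      (auto simp: comp_reduce[OF equivalence_relationD(10)[OF S]])
  obtain j where j: "j \<in> Arr C" "Dom C j = S" "Cod C j = P" "p \<cdot> j = \<Delta>R \<cdot> s0" "q \<cdot> j = Id C S"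
    by (rule pullback_lift[OF P, of "\<Delta>R \<cdot> s0" S "Id C S"])
      (auto simp: comp_reduce[OF equivalence_relationD(11)[OF R]])
  have "pairing C p q (Id C R) (\<Delta>S \<cdot> r1) = i" "pairing C p q (\<Delta>R \<cdot> s0) (Id C S) = j"
    using pairing_eq[OF P] i j by simp_all
  with \<theta> i j show thesis by (intro that[OF P]) auto
qed

section \<open>Smith commuting relations have Huq commuting normalisations\<close>

text \<open>Restrict \<open>\<theta>\<close> to the zigzags \<open>k R 0 S l\<close>.\<close>

lemma huq_commute_if_smith_commute:
  assumes R: "equivalence_relation C A R r0 r1 \<Delta>R" and S: "equivalence_relation C A S s0 s1 \<Delta>S"
    and K: "is_kernel C r0 K k" and L: "is_kernel C s0 L l"
    and RS: "smith_commute C A R r0 r1 \<Delta>R S s0 s1 \<Delta>S"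
  shows "huq_commute C A (r1 \<cdot> k) (s1 \<cdot> l)"
proof -
  note [simp] = equivalence_relationD(1-9,13,14)[OF R] equivalence_relationD(1-9,13,14)[OF S]
    kernel_arr(2,3,5)[OF K] kernel_arr(2,3,5)[OF L]
  have [simp]: "Cod C k = R" "Cod C l = S" using kernel_arr(4)[OF K] kernel_arr(4)[OF L] by simp_all
  have kl: "r0 \<cdot> k = zero_arr C K A" "s0 \<cdot> l = zero_arr C L A"
    using kernel_arr(6)[OF K] kernel_arr(6)[OF L] by simp_all
  obtain P p q \<theta> i j where P: "is_pullback C r1 s0 P p q" and \<theta>: "\<theta> \<in> hom C P A"
    and i: "i \<in> hom C R P" "p \<cdot> i = Id C R" "q \<cdot> i = \<Delta>S \<cdot> r1" "\<theta> \<cdot> i = r0"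
    and j: "j \<in> hom C S P" "p \<cdot> j = \<Delta>R \<cdot> s0" "q \<cdot> j = Id C S" "\<theta> \<cdot> j = s1"
    by (rule smith_commuteE[OF R S RS])
  note [simp] = pullback_arr(3,4,6,10)[OF P] \<theta>[unfolded hom_iff] i(1)[unfolded hom_iff] j(1)[unfolded hom_iff]
  have [simp]: "Cod C p = R" "Dom C q = P" "Cod C q = S" using pullback_arr[OF P] by simp_all
  obtain \<rho> where [simp]: "\<rho> \<in> Arr C" "Dom C \<rho> = K" "Cod C \<rho> = R" and \<rho>: "r0 \<cdot> \<rho> = r1 \<cdot> k" "r1 \<cdot> \<rho> = r0 \<cdot> k"
    by (rule equivalence_relation_sym[OF R, of k K]) auto
  obtain Q a0 a1 where Q: "is_product C K L Q a0 a1"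
    by (rule product_exists[of K L]) auto
  note [simp] = product_arr[OF Q]
  obtain qi where [simp]: "qi \<in> Arr C" "Dom C qi = K" "Cod C qi = Q" and qi: "a0 \<cdot> qi = Id C K" "a1 \<cdot> qi = zero_arr C K L"
    by (rule product_lift[OF Q, of "Id C K" K "zero_arr C K L"]) auto
  obtain qj where [simp]: "qj \<in> Arr C" "Dom C qj = L" "Cod C qj = Q" and qj: "a0 \<cdot> qj = zero_arr C L K" "a1 \<cdot> qj = Id C L"
    by (rule product_lift[OF Q, of "zero_arr C L K" L "Id C L"]) auto
  obtain t where [simp]: "t \<in> Arr C" "Dom C t = Q" "Cod C t = P" and t: "p \<cdot> t = \<rho> \<cdot> a0" "q \<cdot> t = l \<cdot> a1"
    by (rule pullback_lift[OF P, of "\<rho> \<cdot> a0" Q "l \<cdot> a1"])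
      (auto simp: comp_reduce[OF \<rho>(2)] comp_reduce[OF kl(2)] kl)
  note red = comp_reduce[OF t(1)] comp_reduce[OF t(2)] comp_reduce[OF i(2)] comp_reduce[OF i(3)]
    comp_reduce[OF j(2)] comp_reduce[OF j(3)]
  have "t \<cdot> qi = i \<cdot> \<rho>"
    by (rule pullback_ext[OF P, of _ K]) (auto simp: red qi \<rho> kl)
  moreover have "t \<cdot> qj = j \<cdot> l"
    by (rule pullback_ext[OF P, of _ L]) (auto simp: red qj kl)
  ultimately show ?thesis
    by (intro huq_commuteI[OF Q, of "\<theta> \<cdot> t" A qi _ qj])
      (auto simp: qi qj comp_reduce[OF i(4)] comp_reduce[OF j(4)] \<rho>)
qed

section \<open>Star-multiplicative and multiplicative graphs\<close>

lemma star_multiplicativeI: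
  assumes "reflexive_graph C C1 C0 d c e" "is_kernel C d X k" "is_pullback C d (c \<cdot> k) P p0 p1"
    and "\<sigma> \<in> hom C P X"
    and u: "u \<in> hom C X P" "p0 \<cdot> u = k" "p1 \<cdot> u = zero_arr C X X" "\<sigma> \<cdot> u = Id C X"
    and v: "v \<in> hom C X P" "p0 \<cdot> v = e \<cdot> c \<cdot> k" "p1 \<cdot> v = Id C X" "\<sigma> \<cdot> v = Id C X"
  shows "star_multiplicative C C1 C0 d c e"
proof -
  have "pairing C p0 p1 k (zero_arr C X X) = u" "pairing C p0 p1 (e \<cdot> c \<cdot> k) (Id C X) = v"
    using pairing_eq[OF assms(3)] u v by blast+
  then show ?thesis
    unfolding star_multiplicative_def using assms by metis
qed

lemma reflexive_graphD:
  assumes "reflexive_graph C C1 C0 d c e"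
  shows "d \<in> Arr C" "Dom C d = C1" "Cod C d = C0" "c \<in> Arr C" "Dom C c = C1" "Cod C c = C0"
    "e \<in> Arr C" "Dom C e = C0" "Cod C e = C1" "d \<cdot> e = Id C C0" "c \<cdot> e = Id C C0"
    "C0 \<in> Obj C" "C1 \<in> Obj C"
  using assms Dom_in_Obj Cod_in_Obj unfolding reflexive_graph_def by auto

lemma star_multiplicativeE:
  assumes "star_multiplicative C C1 C0 d c e"
  obtains X k P p0 p1 \<sigma> u v where "is_kernel C d X k" "is_pullback C d (c \<cdot> k) P p0 p1"
    "\<sigma> \<in> hom C P X"
    "u \<in> hom C X P" "p0 \<cdot> u = k" "p1 \<cdot> u = zero_arr C X X" "\<sigma> \<cdot> u = Id C X"
    "v \<in> hom C X P" "p0 \<cdot> v = e \<cdot> (c \<cdot> k)" "p1 \<cdot> v = Id C X" "\<sigma> \<cdot> v = Id C X"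
proof -
  have G: "reflexive_graph C C1 C0 d c e" using assms unfolding star_multiplicative_def by blast
  note [simp] = reflexive_graphD(1-9,12,13)[OF G]
  obtain X k P p0 p1 \<sigma> where K: "is_kernel C d X k" and P: "is_pullback C d (c \<cdot> k) P p0 p1"
    and \<sigma>: "\<sigma> \<in> hom C P X" "\<sigma> \<cdot> pairing C p0 p1 k (zero_arr C X X) = Id C X"
      "\<sigma> \<cdot> pairing C p0 p1 (e \<cdot> c \<cdot> k) (Id C X) = Id C X"
    using assms unfolding star_multiplicative_def by blast
  note [simp] = kernel_arr(2,3,5)[OF K]
  have [simp]: "Cod C k = C1" using kernel_arr(4)[OF K] by simp
  have dk: "d \<cdot> k = zero_arr C X C0" using kernel_arr(6)[OF K] by simp
  obtain u where u: "u \<in> Arr C" "Dom C u = X" "Cod C u = P" "p0 \<cdot> u = k" "p1 \<cdot> u = zero_arr C X X"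
    by (rule pullback_lift[OF P, of k X "zero_arr C X X"]) (auto simp: dk)
  obtain v where v: "v \<in> Arr C" "Dom C v = X" "Cod C v = P" "p0 \<cdot> v = e \<cdot> (c \<cdot> k)" "p1 \<cdot> v = Id C X"
    by (rule pullback_lift[OF P, of "e \<cdot> (c \<cdot> k)" X "Id C X"])
      (auto simp: comp_reduce[OF reflexive_graphD(10)[OF G]])
  have "pairing C p0 p1 k (zero_arr C X X) = u" "pairing C p0 p1 (e \<cdot> c \<cdot> k) (Id C X) = v"
    using pairing_eq[OF P] u v by simp_all
  with \<sigma> u v show thesis by (intro that[OF K P, of \<sigma> u v]) auto
qed

lemma multiplicativeE:
  assumes "multiplicative C C1 C0 d c e"
  obtains P p0 p1 m u v where "is_pullback C d c P p0 p1" "m \<in> hom C P C1"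
    "u \<in> hom C C1 P" "p0 \<cdot> u = Id C C1" "p1 \<cdot> u = e \<cdot> d" "m \<cdot> u = Id C C1"
    "v \<in> hom C C1 P" "p0 \<cdot> v = e \<cdot> c" "p1 \<cdot> v = Id C C1" "m \<cdot> v = Id C C1"
proof -
  obtain P p0 p1 m where G: "reflexive_graph C C1 C0 d c e" and P: "is_pullback C d c P p0 p1"
    and m: "m \<in> hom C P C1" "m \<cdot> pairing C p0 p1 (Id C C1) (e \<cdot> d) = Id C C1"
      "m \<cdot> pairing C p0 p1 (e \<cdot> c) (Id C C1) = Id C C1"
    using assms unfolding multiplicative_def internal_category_def by blast
  note [simp] = reflexive_graphD(1-9,12,13)[OF G]
  obtain u where u: "u \<in> Arr C" "Dom C u = C1" "Cod C u = P" "p0 \<cdot> u = Id C C1" "p1 \<cdot> u = e \<cdot> d"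
    by (rule pullback_lift[OF P, of "Id C C1" C1 "e \<cdot> d"])
      (auto simp: comp_reduce[OF reflexive_graphD(11)[OF G]])
  obtain v where v: "v \<in> Arr C" "Dom C v = C1" "Cod C v = P" "p0 \<cdot> v = e \<cdot> c" "p1 \<cdot> v = Id C C1"
    by (rule pullback_lift[OF P, of "e \<cdot> c" C1 "Id C C1"])
      (auto simp: comp_reduce[OF reflexive_graphD(10)[OF G]])
  have "pairing C p0 p1 (Id C C1) (e \<cdot> d) = u" "pairing C p0 p1 (e \<cdot> c) (Id C C1) = v"
    using pairing_eq[OF P] u v by simp_all
  with m u v show thesis by (intro that[OF P, of m u v]) auto
qed

section \<open>The graph of zigzags\<close>

text \<open>Here \<open>P\<close> is the object of zigzags \<open>x R y S z\<close>, with domain \<open>x\<close> and codomain \<open>z\<close>. Composing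
  \<open>0 R y S z\<close> with \<open>z R u S v\<close> amounts to finding \<open>p\<close> with \<open>0 R p S u\<close>. In terms of the
  multiplication \<open>\<phi>\<close> of elements of \<open>K\<close> and \<open>L\<close> one has \<open>z = \<phi>(y, l)\<close> and \<open>u = \<phi>(p, l)\<close> for unique \<open>l\<close>
  and \<open>p\<close>; that \<open>l\<close> and \<open>p\<close> depend on the zigzag through arrows of the category is the content of
  the two isomorphisms \<open>\<alpha>\<close> and \<open>\<beta>\<close>.\<close>

lemma zigzag_graph_star_multiplicative:
  assumes R: "equivalence_relation C A R r0 r1 \<Delta>R" and S: "equivalence_relation C A S s0 s1 \<Delta>S"
    and P: "is_pullback C r1 s0 P p q"
    and e: "e \<in> hom C A P" "p \<cdot> e = \<Delta>R" "q \<cdot> e = \<Delta>S"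
    and K: "is_kernel C r0 K k" and L: "is_kernel C s0 L l"
    and kl: "huq_commute C A (r1 \<cdot> k) (s1 \<cdot> l)"
  shows "star_multiplicative C P A (r0 \<cdot> p) (s1 \<cdot> q) e"
proof -
  note [simp] = equivalence_relationD(1-9,13,14)[OF R] equivalence_relationD(1-9,13,14)[OF S]
    kernel_arr(2,3,5)[OF K] kernel_arr(2,3,5)[OF L] e(1)[unfolded hom_iff]
  note R\<Delta> = equivalence_relationD(10,11)[OF R] and S\<Delta> = equivalence_relationD(10,11)[OF S]
  note R\<Delta>' = R\<Delta>[THEN comp_reduce] and S\<Delta>' = S\<Delta>[THEN comp_reduce]
  note Rjm = jointly_monicD[OF equivalence_relationD(12)[OF R]]
    and Sjm = jointly_monicD[OF equivalence_relationD(12)[OF S]]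
  have [simp]: "Cod C k = R" "Cod C l = S" using kernel_arr(4)[OF K] kernel_arr(4)[OF L] by simp_all
  have k0: "r0 \<cdot> k = zero_arr C K A" and l0: "s0 \<cdot> l = zero_arr C L A"
    using kernel_arr(6)[OF K] kernel_arr(6)[OF L] by simp_all
  note k0' = comp_reduce[OF k0]
  note [simp] = pullback_arr(3,4,6,10)[OF P]
  have [simp]: "Cod C p = R" "Dom C q = P" "Cod C q = S" using pullback_arr[OF P] by simp_all
  note pq = pullback_comm[OF P]
  note pq' = comp_reduce[OF pq]
  note e' = e(2,3)[THEN comp_reduce]
  define d where "d = r0 \<cdot> p"
  define c where "c = s1 \<cdot> q"
  have [simp]: "d \<in> Arr C" "Dom C d = P" "Cod C d = A" "c \<in> Arr C" "Dom C c = P" "Cod C c = A"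
    by (simp_all add: d_def c_def)
  have graph: "reflexive_graph C P A d c e"
    unfolding reflexive_graph_def by (simp add: d_def c_def e R\<Delta> S\<Delta>)
  obtain X x where X: "is_kernel C d X x"
    by (rule kernel_exists[of d P A]) auto
  note [simp] = kernel_arr(2,3,5)[OF X]
  have [simp]: "Cod C x = P" using kernel_arr(4)[OF X] by simp
  have dx: "r0 \<cdot> (p \<cdot> x) = zero_arr C X A" using kernel_arr(6)[OF X] by (simp add: d_def)
  obtain a where [simp]: "a \<in> Arr C" "Dom C a = X" "Cod C a = K" and a: "k \<cdot> a = p \<cdot> x"
    by (rule kernel_lift[OF K, of "p \<cdot> x" X]) (auto simp: dx)
  note a' = comp_reduce[OF a]

  obtain Q \<pi>0 \<pi>1 \<phi> i j where Q: "is_product C K L Q \<pi>0 \<pi>1" and \<phi>: "\<phi> \<in> hom C Q A"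
    and i: "i \<in> hom C K Q" "\<pi>0 \<cdot> i = Id C K" "\<pi>1 \<cdot> i = zero_arr C K L" "\<phi> \<cdot> i = r1 \<cdot> k"
    and j: "j \<in> hom C L Q" "\<pi>0 \<cdot> j = zero_arr C L K" "\<pi>1 \<cdot> j = Id C L" "\<phi> \<cdot> j = s1 \<cdot> l"
    by (rule huq_commuteE[OF kl, of K L]) auto
  note [simp] = product_arr[OF Q] \<phi>[unfolded hom_iff] i(1)[unfolded hom_iff] j(1)[unfolded hom_iff]
  note ij' = i(2-4)[THEN comp_reduce] j(2-4)[THEN comp_reduce]
  have Q_split: "split_epi C Q K \<pi>0 i" by (simp add: split_epi_def i)
  have Q_ker: "is_kernel C \<pi>0 L j"
    by (rule product_kernel[OF product_sym[OF Q]]) (auto simp: j)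
  \<comment> \<open>\<open>y S \<phi>(y, l)\<close>, because this holds for \<open>y = 0\<close> and for \<open>l = 0\<close>.\<close>
  obtain \<psi> where [simp]: "\<psi> \<in> Arr C" "Dom C \<psi> = Q" "Cod C \<psi> = S" and \<psi>: "s0 \<cdot> \<psi> = r1 \<cdot> (k \<cdot> \<pi>0)" "s1 \<cdot> \<psi> = \<phi>"
    by (rule relation_lift[OF Q_split Q_ker, of s0 S A s1 A "r1 \<cdot> (k \<cdot> \<pi>0)" \<phi> l "\<Delta>S \<cdot> (r1 \<cdot> k)"])
      (auto simp: equivalence_relationD[OF S] l0 i j S\<Delta>')
  note \<psi>' = \<psi>[THEN comp_reduce]
  have \<psi>ij: "\<psi> \<cdot> i = \<Delta>S \<cdot> (r1 \<cdot> k)" "\<psi> \<cdot> j = l"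
    by (rule Sjm[of _ K] Sjm[of _ L]; simp add: \<psi>' i j S\<Delta>' l0)+
  note \<psi>ij' = \<psi>ij[THEN comp_reduce]
  have ext_X: "u = v"
    if "u \<in> hom C W X" "v \<in> hom C W X" "p \<cdot> (x \<cdot> u) = p \<cdot> (x \<cdot> v)" "q \<cdot> (x \<cdot> u) = q \<cdot> (x \<cdot> v)" for u v W
  proof (rule kernel_ext[OF X that(1,2)])
    show "x \<cdot> u = x \<cdot> v"
      by (rule pullback_ext[OF P, of _ W]) (use that in auto)
  qed
  \<comment> \<open>\<open>\<alpha>(y, l)\<close> is the zigzag \<open>0 R y S \<phi>(y, l)\<close>.\<close>
  obtain \<alpha>' where [simp]: "\<alpha>' \<in> Arr C" "Dom C \<alpha>' = Q" "Cod C \<alpha>' = P" and \<alpha>': "p \<cdot> \<alpha>' = k \<cdot> \<pi>0" "q \<cdot> \<alpha>' = \<psi>"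
    by (rule pullback_lift[OF P, of "k \<cdot> \<pi>0" Q \<psi>]) (auto simp: \<psi>)
  obtain \<alpha> where [simp]: "\<alpha> \<in> Arr C" "Dom C \<alpha> = Q" "Cod C \<alpha> = X" and x\<alpha>: "x \<cdot> \<alpha> = \<alpha>'"
    by (rule kernel_lift[OF X, of \<alpha>' Q]) (auto simp: d_def \<alpha>' k0')
  note \<alpha>'' = \<alpha>'[THEN comp_reduce] comp_reduce[OF x\<alpha>]
  have a\<alpha>: "a \<cdot> \<alpha> = \<pi>0"
    by (rule kernel_ext[OF K, of _ Q]) (auto simp: a' x\<alpha> \<alpha>')
  note a\<alpha>' = comp_reduce[OF a\<alpha>]
  have "is_iso C \<alpha>"
  proof (rule iso_if_iso_on_base_and_kernel[OF Q_split Q_ker, where f' = a and s' = "\<alpha> \<cdot> i" and b = "Id C K"])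
    show "split_epi C X K a (\<alpha> \<cdot> i)"
      by (simp add: split_epi_def a\<alpha>' i)
    show "is_kernel C a L (\<alpha> \<cdot> j)"
    proof (rule kernelI[of _ X K])
      show "a \<cdot> (\<alpha> \<cdot> j) = zero_arr C L K" by (simp add: a\<alpha>' j)
    next
      fix W w assume w: "w \<in> hom C W X" "a \<cdot> w = zero_arr C W K"
      then have [simp]: "w \<in> Arr C" "Dom C w = W" "Cod C w = X" "W \<in> Obj C" using Dom_in_Obj by auto
      have pxw: "p \<cdot> (x \<cdot> w) = zero_arr C W R" using a'[of w] w by simp
      obtain u where [simp]: "u \<in> Arr C" "Dom C u = W" "Cod C u = L" and u: "l \<cdot> u = q \<cdot> (x \<cdot> w)"
        by (rule kernel_lift[OF L, of "q \<cdot> (x \<cdot> w)" W]) (use pq'[of "x \<cdot> w"] pxw in auto)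
      have "(\<alpha> \<cdot> j) \<cdot> u = w"
        by (rule ext_X[of _ W]) (auto simp: \<alpha>'' ij' \<psi>ij' u pxw)
      then show "\<exists>u. u \<in> hom C W L \<and> (\<alpha> \<cdot> j) \<cdot> u = w" by (intro exI[of _ u]) simp
    next
      fix W u v assume uv: "u \<in> hom C W L" "v \<in> hom C W L" "(\<alpha> \<cdot> j) \<cdot> u = (\<alpha> \<cdot> j) \<cdot> v"
      then have "q \<cdot> (x \<cdot> ((\<alpha> \<cdot> j) \<cdot> u)) = q \<cdot> (x \<cdot> ((\<alpha> \<cdot> j) \<cdot> v))" by (simp only:)
      then have "l \<cdot> u = l \<cdot> v" using uv(1,2) by (simp add: \<alpha>'' \<psi>ij')
      then show "u = v" by (rule kernel_ext[OF L uv(1,2)])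
    qed auto
  qed (auto simp: iso_Id a\<alpha>)
  then obtain \<alpha>i where \<alpha>i_hom: "\<alpha>i \<in> hom C X Q" and \<alpha>i: "\<alpha> \<cdot> \<alpha>i = Id C X"
    by (rule is_isoE[of \<alpha> Q X]) auto
  note [simp] = \<alpha>i_hom[unfolded hom_iff]

  define h where "h = c \<cdot> x"
  have [simp]: "h \<in> Arr C" "Dom C h = X" "Cod C h = A" by (simp_all add: h_def)
  have h\<alpha>: "h \<cdot> \<alpha> = \<phi>" by (simp add: h_def c_def x\<alpha> \<alpha>' \<psi>)
  note h\<alpha>' = comp_reduce[OF h\<alpha>]
  \<comment> \<open>\<open>W\<close> is the object of all \<open>0 R y S z R u\<close>; the section \<open>ws\<close> takes \<open>u = z\<close>.\<close>
  obtain W w0 w1 where W: "is_pullback C h r0 W w0 w1"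
    by (rule pullback_exists[of h r0]) auto
  note [simp] = pullback_arr(3,4,6,10)[OF W]
  have [simp]: "Cod C w0 = X" "Dom C w1 = W" "Cod C w1 = R" using pullback_arr[OF W] by simp_all
  obtain ws where [simp]: "ws \<in> Arr C" "Dom C ws = X" "Cod C ws = W" and ws: "w0 \<cdot> ws = Id C X" "w1 \<cdot> ws = \<Delta>R \<cdot> h"
    by (rule pullback_lift[OF W, of "Id C X" X "\<Delta>R \<cdot> h"]) (auto simp: R\<Delta>')
  note ws' = ws[THEN comp_reduce]

  \<comment> \<open>\<open>Z\<close> is the object of triples \<open>((y, l), p)\<close>; the section \<open>zs\<close> takes \<open>p = y\<close>.\<close>
  obtain Z z0 z1 where Z: "is_product C Q K Z z0 z1"
    by (rule product_exists[of Q K]) auto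
  note [simp] = product_arr[OF Z]
  obtain zs where [simp]: "zs \<in> Arr C" "Dom C zs = Q" "Cod C zs = Z" and zs: "z0 \<cdot> zs = Id C Q" "z1 \<cdot> zs = \<pi>0"
    by (rule product_lift[OF Z, of "Id C Q" Q \<pi>0]) auto
  obtain zk where [simp]: "zk \<in> Arr C" "Dom C zk = K" "Cod C zk = Z" and zk: "z0 \<cdot> zk = zero_arr C K Q" "z1 \<cdot> zk = Id C K"
    by (rule product_lift[OF Z, of "zero_arr C K Q" K "Id C K"]) auto
  note z' = zs[THEN comp_reduce] zk[THEN comp_reduce]
  have Z_split: "split_epi C Z Q z0 zs" by (simp add: split_epi_def zs)
  have Z_ker: "is_kernel C z0 K zk"
    by (rule product_kernel[OF product_sym[OF Z]]) (auto simp: zk)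
  \<comment> \<open>The arrow \<open>y\<close> maps \<open>((y, l), p)\<close> to \<open>(p, l)\<close>.\<close>
  obtain y where [simp]: "y \<in> Arr C" "Dom C y = Z" "Cod C y = Q" and y: "\<pi>0 \<cdot> y = z1" "\<pi>1 \<cdot> y = \<pi>1 \<cdot> z0"
    by (rule product_lift[OF Q, of z1 Z "\<pi>1 \<cdot> z0"]) auto
  note y' = y[THEN comp_reduce]
  have yz: "y \<cdot> zs = Id C Q" "y \<cdot> zk = i"
    by (rule product_ext[OF Q, of _ Q] product_ext[OF Q, of _ K]; simp add: y' zs zk i)+
  \<comment> \<open>\<open>\<phi>(y, l) R \<phi>(p, l)\<close>, because this holds for \<open>p = y\<close> and for \<open>y = l = 0\<close>.\<close>
  obtain \<chi> where [simp]: "\<chi> \<in> Arr C" "Dom C \<chi> = Z" "Cod C \<chi> = R" and \<chi>: "r0 \<cdot> \<chi> = \<phi> \<cdot> z0" "r1 \<cdot> \<chi> = \<phi> \<cdot> y"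
    by (rule relation_lift[OF Z_split Z_ker, of r0 R A r1 A "\<phi> \<cdot> z0" "\<phi> \<cdot> y" k "\<Delta>R \<cdot> \<phi>"])
      (auto simp: equivalence_relationD[OF R] k0 zs zk yz i R\<Delta>')
  note \<chi>' = \<chi>[THEN comp_reduce]
  have \<chi>z: "\<chi> \<cdot> zk = k" "\<chi> \<cdot> zs = \<Delta>R \<cdot> \<phi>"
    by (rule Rjm[of _ K] Rjm[of _ Q]; simp add: \<chi>' zs zk yz i R\<Delta>' k0)+
  \<comment> \<open>\<open>\<beta>((y, l), p)\<close> is \<open>0 R y S \<phi>(y, l) R \<phi>(p, l)\<close>.\<close>
  obtain \<beta> where [simp]: "\<beta> \<in> Arr C" "Dom C \<beta> = Z" "Cod C \<beta> = W" and \<beta>: "w0 \<cdot> \<beta> = \<alpha> \<cdot> z0" "w1 \<cdot> \<beta> = \<chi>"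
    by (rule pullback_lift[OF W, of "\<alpha> \<cdot> z0" Z \<chi>]) (auto simp: h\<alpha>' \<chi>)
  note \<beta>' = \<beta>[THEN comp_reduce]
  have ws\<alpha>: "ws \<cdot> \<alpha> = \<beta> \<cdot> zs"
    by (rule pullback_ext[OF W, of _ Q]) (auto simp: ws' \<beta>' zs \<chi>z h\<alpha>)
  have "is_iso C \<beta>"
  proof (rule iso_if_iso_on_base_and_kernel[OF Z_split Z_ker, where f' = w0 and s' = ws and b = \<alpha>])
    show "split_epi C W X w0 ws" by (simp add: split_epi_def ws)
    show "is_kernel C w0 K (\<beta> \<cdot> zk)"
      by (rule pullback_kernel[OF pullback_sym[OF W] K]) (auto simp: \<beta>' \<chi>z zk)
  qed (use \<open>is_iso C \<alpha>\<close> in \<open>auto simp: \<beta> ws\<alpha>\<close>)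
  then obtain \<gamma> where \<gamma>_hom: "\<gamma> \<in> hom C W Z" and \<gamma>: "\<gamma> \<cdot> \<beta> = Id C Z" "\<beta> \<cdot> \<gamma> = Id C W"
    by (rule is_isoE[of \<beta> Z W]) auto
  note [simp] = \<gamma>_hom[unfolded hom_iff]
  note \<gamma>' = \<gamma>[THEN comp_reduce]
  have \<gamma>ws: "\<gamma> \<cdot> ws = zs \<cdot> \<alpha>i"
  proof -
    have "(ws \<cdot> \<alpha>) \<cdot> \<alpha>i = ws" by (simp add: \<alpha>i)
    then have "ws = \<beta> \<cdot> (zs \<cdot> \<alpha>i)" by (simp add: ws\<alpha>)
    then show ?thesis by (simp add: \<gamma>')
  qed
  have a\<alpha>i: "a = \<pi>0 \<cdot> \<alpha>i"
    using a\<alpha>'[of \<alpha>i] \<alpha>i by simp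
  have r1w1: "r1 \<cdot> w1 = \<phi> \<cdot> (y \<cdot> \<gamma>)"
    using \<chi>'(2)[of \<gamma>] \<beta>'(2)[of \<gamma>] \<gamma> by simp
  note r1w1' = comp_reduce[OF r1w1]

  \<comment> \<open>A composable pair consists of \<open>z R u S v\<close> and \<open>0 R y S z\<close>; \<open>t\<close> forgets \<open>v\<close>, and \<open>b\<close> is the fourth
    vertex \<open>p\<close>.\<close>
  obtain D d0 d1 where D: "is_pullback C d h D d0 d1"
    by (rule pullback_exists[of d h]) auto
  note [simp] = pullback_arr(3,4,6,10)[OF D]
  have [simp]: "Cod C d0 = P" "Dom C d1 = D" "Cod C d1 = X" using pullback_arr[OF D] by simp_all
  have dd: "r0 \<cdot> (p \<cdot> d0) = h \<cdot> d1" using pullback_comm[OF D] by (simp add: d_def)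
  obtain t where [simp]: "t \<in> Arr C" "Dom C t = D" "Cod C t = W" and t: "w0 \<cdot> t = d1" "w1 \<cdot> t = p \<cdot> d0"
    by (rule pullback_lift[OF W, of d1 D "p \<cdot> d0"]) (auto simp: dd)
  note t' = t[THEN comp_reduce]
  define b where "b = z1 \<cdot> (\<gamma> \<cdot> t)"
  have [simp]: "b \<in> Arr C" "Dom C b = D" "Cod C b = K" by (simp_all add: b_def)
  \<comment> \<open>\<open>p S u\<close> and \<open>u S v\<close> give \<open>p S v\<close>.\<close>
  obtain \<tau> where [simp]: "\<tau> \<in> Arr C" "Dom C \<tau> = D" "Cod C \<tau> = S"
      and "s0 \<cdot> \<tau> = s0 \<cdot> (\<psi> \<cdot> (y \<cdot> (\<gamma> \<cdot> t)))" and \<tau>1: "s1 \<cdot> \<tau> = s1 \<cdot> (q \<cdot> d0)"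
    by (rule equivalence_relation_trans[OF S, of "\<psi> \<cdot> (y \<cdot> (\<gamma> \<cdot> t))" D "q \<cdot> d0"])
      (use pq'[of d0] r1w1'[of t] in \<open>auto simp: \<psi>' t\<close>)
  then have \<tau>0: "s0 \<cdot> \<tau> = r1 \<cdot> (k \<cdot> b)" by (simp add: \<psi>' y' b_def)
  note \<tau>' = \<tau>0[THEN comp_reduce] \<tau>1[THEN comp_reduce]
  obtain \<sigma>' where [simp]: "\<sigma>' \<in> Arr C" "Dom C \<sigma>' = D" "Cod C \<sigma>' = P" and \<sigma>': "p \<cdot> \<sigma>' = k \<cdot> b" "q \<cdot> \<sigma>' = \<tau>"
    by (rule pullback_lift[OF P, of "k \<cdot> b" D \<tau>]) (auto simp: \<tau>0)
  obtain \<sigma> where [simp]: "\<sigma> \<in> Arr C" "Dom C \<sigma> = D" "Cod C \<sigma> = X" and \<sigma>: "x \<cdot> \<sigma> = \<sigma>'"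
    by (rule kernel_lift[OF X, of \<sigma>' D]) (auto simp: d_def \<sigma>' k0')
  note \<sigma>'' = \<sigma>'[THEN comp_reduce] comp_reduce[OF \<sigma>]
  obtain u where [simp]: "u \<in> Arr C" "Dom C u = X" "Cod C u = D" and u: "d0 \<cdot> u = x" "d1 \<cdot> u = zero_arr C X X"
    by (rule pullback_lift[OF D, of x X "zero_arr C X X"]) (auto simp: d_def dx)
  obtain v where [simp]: "v \<in> Arr C" "Dom C v = X" "Cod C v = D" and v: "d0 \<cdot> v = e \<cdot> h" "d1 \<cdot> v = Id C X"
    by (rule pullback_lift[OF D, of "e \<cdot> h" X "Id C X"]) (auto simp: d_def e' R\<Delta>')
  have "t \<cdot> u = \<beta> \<cdot> (zk \<cdot> a)"
    by (rule pullback_ext[OF W, of _ X]) (auto simp: t' u \<beta>' z' comp_reduce[OF \<chi>z(1)] a)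
  then have bu: "b \<cdot> u = a"
    by (simp add: b_def \<gamma>' z')
  have "t \<cdot> v = ws"
    by (rule pullback_ext[OF W, of _ X]) (auto simp: t' v ws e')
  then have bv: "b \<cdot> v = a"
    by (simp add: b_def \<gamma>ws z' a\<alpha>i)
  have qx: "s0 \<cdot> (q \<cdot> x) = r1 \<cdot> (k \<cdot> a)"
    by (simp add: a pq')
  have 1: "\<tau> \<cdot> u = q \<cdot> x"
    by (rule Sjm[of _ X]) (auto simp: \<tau>' bu qx u)
  have 2: "\<sigma> \<cdot> u = Id C X"
    by (rule ext_X[of _ X]) (auto simp: 1 \<sigma>'' bu a)
  have 1: "\<tau> \<cdot> v = q \<cdot> x"
    by (rule Sjm[of _ X]) (auto simp: \<tau>' bv qx v e' S\<Delta>' h_def c_def)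
  have 2: "\<sigma> \<cdot> v = Id C X"
    by (rule ext_X[of _ X]) (auto simp: 1 \<sigma>'' bv a)
  have "star_multiplicative C P A d c e"
    by (rule star_multiplicativeI[OF graph X D[unfolded h_def], of \<sigma> u v])
      (use \<open>\<sigma> \<cdot> u = Id C X\<close> \<open>\<sigma> \<cdot> v = Id C X\<close> u v in \<open>simp_all add: h_def\<close>)
  then show ?thesis by (simp add: d_def c_def)
qed

text \<open>The composite of \<open>z R z S y\<close> and \<open>y R x S x\<close> is a zigzag \<open>z R \<theta> S x\<close>. One of the factors is an
  identity if \<open>y = z\<close> or \<open>x = y\<close>, and then \<open>\<theta>\<close> is \<open>x\<close> or \<open>z\<close>, respectively.\<close>

lemma smith_commute_if_zigzag_graph_multiplicative:
  assumes R: "equivalence_relation C A R r0 r1 \<Delta>R" and S: "equivalence_relation C A S s0 s1 \<Delta>S"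
    and P: "is_pullback C r1 s0 P p q"
    and e: "e \<in> hom C A P" "p \<cdot> e = \<Delta>R" "q \<cdot> e = \<Delta>S"
    and mult: "multiplicative C P A (r0 \<cdot> p) (s1 \<cdot> q) e"
  shows "smith_commute C A R r0 r1 \<Delta>R S s0 s1 \<Delta>S"
proof -
  note [simp] = equivalence_relationD(1-9,13,14)[OF R] equivalence_relationD(1-9,13,14)[OF S]
    e(1)[unfolded hom_iff]
  note R\<Delta> = equivalence_relationD(10,11)[OF R] and S\<Delta> = equivalence_relationD(10,11)[OF S]
  note R\<Delta>' = R\<Delta>[THEN comp_reduce] and S\<Delta>' = S\<Delta>[THEN comp_reduce]
  note Rjm = jointly_monicD[OF equivalence_relationD(12)[OF R]]
    and Sjm = jointly_monicD[OF equivalence_relationD(12)[OF S]]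
  note [simp] = pullback_arr(3,4,6,10)[OF P]
  have [simp]: "Cod C p = R" "Dom C q = P" "Cod C q = S" using pullback_arr[OF P] by simp_all
  note pq = pullback_comm[OF P]
  note e' = e(2,3)[THEN comp_reduce]
  obtain D d0 d1 m u v where D: "is_pullback C (r0 \<cdot> p) (s1 \<cdot> q) D d0 d1" and m: "m \<in> hom C D P"
    and u: "u \<in> hom C P D" "d0 \<cdot> u = Id C P" "d1 \<cdot> u = e \<cdot> (r0 \<cdot> p)" "m \<cdot> u = Id C P"
    and v: "v \<in> hom C P D" "d0 \<cdot> v = e \<cdot> (s1 \<cdot> q)" "d1 \<cdot> v = Id C P" "m \<cdot> v = Id C P"
    by (rule multiplicativeE[OF mult])
  note [simp] = m[unfolded hom_iff] u(1)[unfolded hom_iff] v(1)[unfolded hom_iff]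
  note uv' = u(2-4)[THEN comp_reduce] v(2-4)[THEN comp_reduce]
  have [simp]: "d0 \<in> Arr C" "Dom C d0 = D" "Cod C d0 = P" "d1 \<in> Arr C" "Dom C d1 = D" "Cod C d1 = P"
    using pullback_arr[OF D] by simp_all
  obtain \<rho> where [simp]: "\<rho> \<in> Arr C" "Dom C \<rho> = P" "Cod C \<rho> = R" and \<rho>: "r0 \<cdot> \<rho> = r1 \<cdot> p" "r1 \<cdot> \<rho> = r0 \<cdot> p"
    by (rule equivalence_relation_sym[OF R, of p P]) auto
  obtain \<sigma> where [simp]: "\<sigma> \<in> Arr C" "Dom C \<sigma> = P" "Cod C \<sigma> = S" and \<sigma>: "s0 \<cdot> \<sigma> = s1 \<cdot> q" "s1 \<cdot> \<sigma> = s0 \<cdot> q"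
    by (rule equivalence_relation_sym[OF S, of q P]) auto
  note \<rho>\<sigma>' = \<rho>[THEN comp_reduce] \<sigma>[THEN comp_reduce]
  \<comment> \<open>\<open>f\<close> sends \<open>x R y S z\<close> to \<open>z R z S y\<close>, and \<open>g\<close> sends it to \<open>y R x S x\<close>.\<close>
  obtain f where [simp]: "f \<in> Arr C" "Dom C f = P" "Cod C f = P" and f: "p \<cdot> f = \<Delta>R \<cdot> (s1 \<cdot> q)" "q \<cdot> f = \<sigma>"
    by (rule pullback_lift[OF P, of "\<Delta>R \<cdot> (s1 \<cdot> q)" P \<sigma>]) (auto simp: R\<Delta>' \<sigma>)
  obtain g where [simp]: "g \<in> Arr C" "Dom C g = P" "Cod C g = P" and g: "p \<cdot> g = \<rho>" "q \<cdot> g = \<Delta>S \<cdot> (r0 \<cdot> p)"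
    by (rule pullback_lift[OF P, of \<rho> P "\<Delta>S \<cdot> (r0 \<cdot> p)"]) (auto simp: S\<Delta>' \<rho>)
  note fg' = f[THEN comp_reduce] g[THEN comp_reduce]
  obtain t where [simp]: "t \<in> Arr C" "Dom C t = P" "Cod C t = D" and t: "d0 \<cdot> t = g" "d1 \<cdot> t = f"
    by (rule pullback_lift[OF D, of g P f]) (auto simp: f g \<rho> \<sigma> pq)
  note t' = t[THEN comp_reduce]
  obtain i where [simp]: "i \<in> Arr C" "Dom C i = R" "Cod C i = P" and i: "p \<cdot> i = Id C R" "q \<cdot> i = \<Delta>S \<cdot> r1"
    by (rule pullback_lift[OF P, of "Id C R" R "\<Delta>S \<cdot> r1"]) (auto simp: S\<Delta>')
  obtain j where [simp]: "j \<in> Arr C" "Dom C j = S" "Cod C j = P" and j: "p \<cdot> j = \<Delta>R \<cdot> s0" "q \<cdot> j = Id C S"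
    by (rule pullback_lift[OF P, of "\<Delta>R \<cdot> s0" S "Id C S"]) (auto simp: R\<Delta>')
  have 1: "\<sigma> \<cdot> i = \<Delta>S \<cdot> r1"
    by (rule Sjm[of _ R]) (auto simp: \<rho>\<sigma>' i S\<Delta>')
  have 2: "f \<cdot> i = e \<cdot> (r0 \<cdot> (p \<cdot> (g \<cdot> i)))"
    by (rule pullback_ext[OF P, of _ R]) (auto simp: 1 fg' \<rho>\<sigma>' i S\<Delta>' e')
  have "t \<cdot> i = u \<cdot> (g \<cdot> i)"
    by (rule pullback_ext[OF D, of _ R]) (auto simp: t' uv' 2)
  then have \<theta>i: "(r1 \<cdot> (p \<cdot> (m \<cdot> t))) \<cdot> i = r0"
    by (simp add: uv' fg' \<rho>\<sigma>' i)
  have 1: "\<rho> \<cdot> j = \<Delta>R \<cdot> s0"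
    by (rule Rjm[of _ S]) (auto simp: \<rho>\<sigma>' j R\<Delta>')
  have 2: "g \<cdot> j = e \<cdot> (s1 \<cdot> (q \<cdot> (f \<cdot> j)))"
    by (rule pullback_ext[OF P, of _ S]) (auto simp: 1 fg' \<rho>\<sigma>' j R\<Delta>' e')
  have "t \<cdot> j = v \<cdot> (f \<cdot> j)"
    by (rule pullback_ext[OF D, of _ S]) (auto simp: t' uv' 2)
  then have \<theta>j: "(r1 \<cdot> (p \<cdot> (m \<cdot> t))) \<cdot> j = s1"
    by (simp add: uv' fg' \<rho>\<sigma>' j R\<Delta>')
  show ?thesis
    by (rule smith_commuteI[OF R S P, of "r1 \<cdot> (p \<cdot> (m \<cdot> t))" i j]) (use i j \<theta>i \<theta>j in auto)
qed

section \<open>Commuting kernel pairs make a graph an internal category\<close>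

text \<open>The composite \<open>\<theta>(g, e d g, f)\<close> makes sense as \<open>e d g = e c f\<close> has the domain of \<open>g\<close> and the codomain
  of \<open>f\<close>. The unit laws are the two equations for \<open>\<theta>\<close>. The other laws hold by joint epicness:
  \<open>p1\<close> is split by \<open>f \<mapsto> (e c f, f)\<close> with kernel \<open>x \<mapsto> (x, 0)\<close>, so composites are determined by the
  unit laws.\<close>

lemma multiplicative_if_kernel_pairs_smith_commute:
  assumes G: "reflexive_graph C C1 C0 d c e"
    and Rpb: "is_pullback C d d R r0 r1" and R: "equivalence_relation C C1 R r0 r1 \<Delta>R"
    and Spb: "is_pullback C c c S s0 s1" and S: "equivalence_relation C C1 S s0 s1 \<Delta>S"
    and RS: "smith_commute C C1 R r0 r1 \<Delta>R S s0 s1 \<Delta>S"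
  shows "multiplicative C C1 C0 d c e"
proof -
  note [simp] = reflexive_graphD(1-9,12,13)[OF G]
    equivalence_relationD(1-9,14)[OF R] equivalence_relationD(1-9,14)[OF S]
  note de = reflexive_graphD(10)[OF G] and ce = reflexive_graphD(11)[OF G]
  note de' = comp_reduce[OF de] and ce' = comp_reduce[OF ce]
  note R\<Delta>' = equivalence_relationD(10,11)[OF R, THEN comp_reduce]
    and S\<Delta>' = equivalence_relationD(10,11)[OF S, THEN comp_reduce]
  obtain T t0 t1 \<theta> i j where T: "is_pullback C r1 s0 T t0 t1" and \<theta>: "\<theta> \<in> hom C T C1"
    and i: "i \<in> hom C R T" "t0 \<cdot> i = Id C R" "t1 \<cdot> i = \<Delta>S \<cdot> r1" "\<theta> \<cdot> i = r0"
    and j: "j \<in> hom C S T" "t0 \<cdot> j = \<Delta>R \<cdot> s0" "t1 \<cdot> j = Id C S" "\<theta> \<cdot> j = s1"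
    by (rule smith_commuteE[OF R S RS])
  note [simp] = \<theta>[unfolded hom_iff] i(1)[unfolded hom_iff] j(1)[unfolded hom_iff] pullback_arr(3,4,6,10)[OF T]
  have [simp]: "Cod C t0 = R" "Dom C t1 = T" "Cod C t1 = S" using pullback_arr[OF T] by simp_all
  note ij' = i(2-4)[THEN comp_reduce] j(2-4)[THEN comp_reduce]
  obtain P p0 p1 where P: "is_pullback C d c P p0 p1"
    by (rule pullback_exists[of d c]) auto
  note [simp] = pullback_arr(3,4,6,10)[OF P]
  have [simp]: "Cod C p0 = C1" "Dom C p1 = P" "Cod C p1 = C1" using pullback_arr[OF P] by simp_all
  note pp = pullback_comm[OF P]
  note pp' = comp_reduce[OF pp]
  obtain a where [simp]: "a \<in> Arr C" "Dom C a = C1" "Cod C a = R" and a: "r0 \<cdot> a = Id C C1" "r1 \<cdot> a = e \<cdot> d"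
    by (rule pullback_lift[OF Rpb, of "Id C C1" C1 "e \<cdot> d"]) (auto simp: de')
  obtain b where [simp]: "b \<in> Arr C" "Dom C b = C1" "Cod C b = S" and b: "s0 \<cdot> b = e \<cdot> c" "s1 \<cdot> b = Id C C1"
    by (rule pullback_lift[OF Spb, of "e \<cdot> c" C1 "Id C C1"]) (auto simp: ce')
  note ab' = a[THEN comp_reduce] b[THEN comp_reduce]
  obtain z where [simp]: "z \<in> Arr C" "Dom C z = P" "Cod C z = T" and z: "t0 \<cdot> z = a \<cdot> p0" "t1 \<cdot> z = b \<cdot> p1"
    by (rule pullback_lift[OF T, of "a \<cdot> p0" P "b \<cdot> p1"]) (auto simp: ab' pp)
  note z' = z[THEN comp_reduce]
  define m where "m = \<theta> \<cdot> z"
  have [simp]: "m \<in> Arr C" "Dom C m = P" "Cod C m = C1" by (simp_all add: m_def)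
  obtain u where [simp]: "u \<in> Arr C" "Dom C u = C1" "Cod C u = P" and u: "p0 \<cdot> u = Id C C1" "p1 \<cdot> u = e \<cdot> d"
    by (rule pullback_lift[OF P, of "Id C C1" C1 "e \<cdot> d"]) (auto simp: ce')
  obtain v where [simp]: "v \<in> Arr C" "Dom C v = C1" "Cod C v = P" and v: "p0 \<cdot> v = e \<cdot> c" "p1 \<cdot> v = Id C C1"
    by (rule pullback_lift[OF P, of "e \<cdot> c" C1 "Id C C1"]) (auto simp: de')
  note uv' = u[THEN comp_reduce] v[THEN comp_reduce]
  \<comment> \<open>\<open>e d g\<close> is an identity, so its codomain is \<open>d g\<close> as well; likewise for \<open>e c f\<close>.\<close>
  have bed: "b \<cdot> (e \<cdot> d) = \<Delta>S \<cdot> (e \<cdot> d)"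
    by (rule jointly_monicD[OF equivalence_relationD(12)[OF S], of _ C1]) (auto simp: ab' S\<Delta>' ce')
  have aec: "a \<cdot> (e \<cdot> c) = \<Delta>R \<cdot> (e \<cdot> c)"
    by (rule jointly_monicD[OF equivalence_relationD(12)[OF R], of _ C1]) (auto simp: ab' R\<Delta>' de')
  have zu: "z \<cdot> u = i \<cdot> a"
    by (rule pullback_ext[OF T, of _ C1]) (auto simp: z' u ij' bed a)
  have zv: "z \<cdot> v = j \<cdot> b"
    by (rule pullback_ext[OF T, of _ C1]) (auto simp: z' v ij' aec b)
  have mu: "m \<cdot> u = Id C C1" and mv: "m \<cdot> v = Id C C1"
    by (simp_all add: m_def zu zv ij' a b)
  note m' = mu[THEN comp_reduce] mv[THEN comp_reduce]

  obtain X k where X: "is_kernel C d X k"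
    by (rule kernel_exists[of d C1 C0]) auto
  note [simp] = kernel_arr(2,3,5)[OF X]
  have [simp]: "Cod C k = C1" using kernel_arr(4)[OF X] by simp
  have dk: "d \<cdot> k = zero_arr C X C0" using kernel_arr(6)[OF X] by simp
  obtain w where [simp]: "w \<in> Arr C" "Dom C w = X" "Cod C w = P" and w: "p0 \<cdot> w = k" "p1 \<cdot> w = zero_arr C X C1"
    by (rule pullback_lift[OF P, of k X "zero_arr C X C1"]) (auto simp: dk)
  have P_ker: "is_kernel C p1 X w"
    by (rule pullback_kernel[OF P X]) (auto simp: w)
  have P_split: "split_epi C P C1 p1 v" by (simp add: split_epi_def v)
  have wu: "w = u \<cdot> k"
    by (rule pullback_ext[OF P, of _ X]) (auto simp: w uv' dk)
  have mw: "m \<cdot> w = k"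
    by (simp add: wu m')
  have dm: "d \<cdot> m = d \<cdot> p1"
    by (rule jointly_epic[OF P_split P_ker, of _ C0]) (auto simp: mw w dk mv v)
  have cm: "c \<cdot> m = c \<cdot> p0"
    by (rule jointly_epic[OF P_split P_ker, of _ C0]) (auto simp: mw w mv v ce')
  note dcm' = dm[THEN comp_reduce] cm[THEN comp_reduce]

  \<comment> \<open>Associativity need only be checked for triples \<open>(x, 0, 0)\<close> and for triples whose first entry is an
    identity.\<close>
  obtain Q q0 q1 where Q: "is_pullback C p1 p0 Q q0 q1"
    by (rule pullback_exists[of p1 p0]) auto
  note [simp] = pullback_arr(3,4,6,10)[OF Q]
  have [simp]: "Cod C q0 = P" "Dom C q1 = Q" "Cod C q1 = P" using pullback_arr[OF Q] by simp_all
  note qq = pullback_comm[OF Q]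
  obtain l where [simp]: "l \<in> Arr C" "Dom C l = Q" "Cod C l = P" and l: "p0 \<cdot> l = p0 \<cdot> q0" "p1 \<cdot> l = m \<cdot> q1"
    by (rule pullback_lift[OF P, of "p0 \<cdot> q0" Q "m \<cdot> q1"]) (use pp'[of q0] qq in \<open>auto simp: dcm'\<close>)
  obtain r where [simp]: "r \<in> Arr C" "Dom C r = Q" "Cod C r = P" and r: "p0 \<cdot> r = m \<cdot> q0" "p1 \<cdot> r = p1 \<cdot> q1"
    by (rule pullback_lift[OF P, of "m \<cdot> q0" Q "p1 \<cdot> q1"]) (use pp'[of q1] qq in \<open>auto simp: dcm'\<close>)
  note lr' = l[THEN comp_reduce] r[THEN comp_reduce]
  obtain s where [simp]: "s \<in> Arr C" "Dom C s = P" "Cod C s = Q" and s: "q0 \<cdot> s = v \<cdot> p0" "q1 \<cdot> s = Id C P"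
    by (rule pullback_lift[OF Q, of "v \<cdot> p0" P "Id C P"]) (auto simp: uv')
  obtain n where [simp]: "n \<in> Arr C" "Dom C n = X" "Cod C n = Q" and n: "q0 \<cdot> n = w" "q1 \<cdot> n = zero_arr C X P"
    by (rule pullback_lift[OF Q, of w X "zero_arr C X P"]) (auto simp: w)
  have Q_split: "split_epi C Q P q1 s" by (simp add: split_epi_def s)
  have Q_ker: "is_kernel C q1 X n"
    by (rule pullback_kernel[OF Q P_ker]) (auto simp: n)
  have ls: "l \<cdot> s = v \<cdot> m"
    by (rule pullback_ext[OF P, of _ P]) (auto simp: lr' s uv' cm)
  have rs: "r \<cdot> s = Id C P"
    by (rule pullback_ext[OF P, of _ P]) (auto simp: lr' s m')
  have ln: "l \<cdot> n = w"
    by (rule pullback_ext[OF P, of _ X]) (auto simp: lr' n w)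
  have rn: "r \<cdot> n = w"
    by (rule pullback_ext[OF P, of _ X]) (auto simp: lr' n w mw)
  have "m \<cdot> l = m \<cdot> r"
    by (rule jointly_epic[OF Q_split Q_ker, of _ C1]) (auto simp: ln rn ls rs m')
  moreover have "pairing C p0 p1 (p0 \<cdot> q0) (m \<cdot> q1) = l" "pairing C p0 p1 (m \<cdot> q0) (p1 \<cdot> q1) = r"
    "pairing C p0 p1 (Id C C1) (e \<cdot> d) = u" "pairing C p0 p1 (e \<cdot> c) (Id C C1) = v"
    using pairing_eq[OF P] l r u v by simp_all
  ultimately have "internal_category C C1 C0 d c e P p0 p1 m"
    unfolding internal_category_def using G P Q dm cm mu mv by (simp, metis)
  then show ?thesis unfolding multiplicative_def by blast
qed

end

section \<open>Regular protomodular categories\<close>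

locale regular_protomodular_category = protomodular_category C
  for C :: "('o, 'm) precategory" (structure) +
  assumes regular: "regular C"
begin

lemma regular_epi_pullback: "is_pullback C f g P p q \<Longrightarrow> regular_epi C f \<Longrightarrow> regular_epi C q"
  using regular unfolding regular_def by blast

lemma coequaliser_unique:
  assumes "is_coequaliser C u v q" "a \<in> hom C (Cod C q) W" "b \<in> hom C (Cod C q) W" "a \<cdot> q = b \<cdot> q"
  shows "a = b"
proof -
  have q: "u \<in> Arr C" "v \<in> Arr C" "q \<in> Arr C" "Dom C q = Cod C u" "Dom C q = Cod C v" "q \<cdot> u = q \<cdot> v"
    using assms unfolding is_coequaliser_def by auto
  then have "(b \<cdot> q) \<cdot> u = (b \<cdot> q) \<cdot> v" "b \<cdot> q \<in> hom C (Cod C u) W"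
    using assms(3) by auto
  then have "\<exists>!w. w \<in> hom C (Cod C q) W \<and> w \<cdot> q = b \<cdot> q"
    using assms(1) unfolding is_coequaliser_def by blast
  then show ?thesis using assms by blast
qed

lemma regular_epi_epic:
  assumes "regular_epi C q" "a \<in> hom C (Cod C q) W" "b \<in> hom C (Cod C q) W" "a \<cdot> q = b \<cdot> q"
  shows "a = b"
  using assms coequaliser_unique unfolding regular_epi_def by blast

lemma coequaliser_factor:
  assumes "is_coequaliser C u v q" "q \<in> hom C A I" "t \<in> hom C A W" "t \<cdot> u = t \<cdot> v"
  obtains w where "w \<in> hom C I W" "w \<cdot> q = t"
proof -
  have "Cod C u = A" "Cod C q = I"
    using assms unfolding is_coequaliser_def by auto
  moreover have "\<forall>W. \<forall>t \<in> hom C (Cod C u) W. t \<cdot> u = t \<cdot> v \<longrightarrow> (\<exists>!w. w \<in> hom C (Cod C q) W \<and> w \<cdot> q = t)"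
    using assms(1) unfolding is_coequaliser_def by (elim conjE)
  ultimately have "\<exists>!w. w \<in> hom C I W \<and> w \<cdot> q = t"
    using assms(3,4) by (simp del: hom_iff)
  then show thesis using that by blast
qed

text \<open>The coequaliser \<open>q\<close> of the kernel pair is the image. If \<open>m a = 0\<close>, then locally \<open>a\<close> is the value of
  \<open>q\<close> at some \<open>p\<close> with \<open>f p = 0\<close>, so \<open>p\<close> and \<open>0\<close> are identified by \<open>q\<close> and \<open>a = 0\<close>. Hence \<open>m\<close> is monic.\<close>

lemma image_factorisation:
  assumes f: "f \<in> hom C A B"
  obtains I q m u v where "is_coequaliser C u v q" "q \<in> hom C A I" "m \<in> hom C I B" "monic m" "m \<cdot> q = f"
proof -
  have [simp]: "f \<in> Arr C" "Dom C f = A" "Cod C f = B" "A \<in> Obj C" "B \<in> Obj C"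
    using f Dom_in_Obj Cod_in_Obj by auto
  obtain R r0 r1 where R: "is_pullback C f f R r0 r1"
    by (rule pullback_exists[of f f]) auto
  note [simp] = pullback_arr[OF R]
  obtain \<Delta> where "equivalence_relation C (Dom C f) R r0 r1 \<Delta>"
    by (rule kernel_pair_equivalence_relation[OF R])
  then have "equivalence_relation C A R r0 r1 \<Delta>" by simp
  moreover have "effective C A R r0 r1"
    unfolding effective_def using R f by blast
  ultimately obtain q where q: "is_coequaliser C r0 r1 q"
    using regular unfolding regular_def by blast
  have [simp]: "q \<in> Arr C" "Dom C q = A" and qr: "q \<cdot> r0 = q \<cdot> r1"
    using q unfolding is_coequaliser_def by auto
  define I where "I = Cod C q"
  have [simp]: "Cod C q = I" "I \<in> Obj C" by (auto simp: I_def Cod_in_Obj)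
  have "f \<cdot> r0 = f \<cdot> r1" by (rule pullback_comm[OF R])
  then obtain m where "m \<in> hom C I B" and mq: "m \<cdot> q = f"
    by (rule coequaliser_factor[OF q, of A I f B, rotated 2]) simp_all
  then have [simp]: "m \<in> Arr C" "Dom C m = I" "Cod C m = B" by auto
  have "monic m"
  proof (rule monic_if_trivial_kernel[of m I B])
    fix W a assume a: "a \<in> hom C W I" "m \<cdot> a = zero_arr C W B"
    then have [simp]: "a \<in> Arr C" "Dom C a = W" "Cod C a = I" "W \<in> Obj C"
      using Dom_in_Obj by auto
    obtain W' p r where W': "is_pullback C q a W' p r"
      by (rule pullback_exists[of q a]) auto
    note [simp] = pullback_arr[OF W']
    have "regular_epi C q" using q by (auto simp: regular_epi_def)
    then have r: "regular_epi C r" by (rule regular_epi_pullback[OF W'])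
    have qp: "q \<cdot> p = a \<cdot> r" by (rule pullback_comm[OF W'])
    have "f \<cdot> p = m \<cdot> (a \<cdot> r)"
      using comp_reduce[OF mq, of p] qp by simp
    then have "f \<cdot> p = f \<cdot> zero_arr C W' A"
      using comp_reduce[OF a(2), of r] by simp
    then obtain w where [simp]: "w \<in> Arr C" "Dom C w = W'" "Cod C w = R"
        and w: "r0 \<cdot> w = p" "r1 \<cdot> w = zero_arr C W' A"
      by (rule pullback_lift[OF R, rotated 2]) auto
    have "q \<cdot> p = zero_arr C W' I"
      using comp_reduce[OF qr, of w] w by simp
    then have "a \<cdot> r = zero_arr C W I \<cdot> r"
      using qp by simp
    then show "a = zero_arr C W I"
      using regular_epi_epic[OF r] by simp
  qed auto
  then show thesis
    by (intro that[OF q _ _ _ mq]) auto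
qed

text \<open>The monic part of the image factorisation is hit by the kernel and by the section.\<close>

lemma regular_epi_if_lifts:
  assumes f: "split_epi C A B f s" "is_kernel C f K i"
    and g: "g \<in> hom C G A"
    and i': "i' \<in> hom C K G" "g \<cdot> i' = i" and s': "s' \<in> hom C B G" "g \<cdot> s' = s"
  shows "regular_epi C g"
proof -
  obtain I q m u v where q: "is_coequaliser C u v q" "q \<in> hom C G I" and m: "m \<in> hom C I A" "monic m"
      and mq: "m \<cdot> q = g"
    by (rule image_factorisation[OF g])
  note [simp] = q(2)[unfolded hom_iff] m(1)[unfolded hom_iff] g[unfolded hom_iff]
    i'(1)[unfolded hom_iff] s'(1)[unfolded hom_iff]
  have "is_iso C m"
    by (rule iso_if_monic_and_lifts[OF f m(2,1), of "q \<cdot> i'" "q \<cdot> s'"])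
      (use comp_reduce[OF mq] i' s' in auto)
  then obtain n where n: "n \<in> hom C A I" "n \<cdot> m = Id C I" "m \<cdot> n = Id C A"
    by (rule is_isoE) (rule m)
  note [simp] = n(1)[unfolded hom_iff]
  have [simp]: "A \<in> Obj C" using Cod_in_Obj[of m] by simp
  have uv: "u \<in> Arr C" "v \<in> Arr C" "Dom C u = Dom C v" "Cod C u = G" "Cod C v = G" "q \<cdot> u = q \<cdot> v"
    using q unfolding is_coequaliser_def by auto
  note [simp] = uv(1-5)
  have "is_coequaliser C u v g"
    unfolding is_coequaliser_def
  proof (intro conjI allI ballI impI)
    show "g \<cdot> u = g \<cdot> v"
      using comp_reduce[OF mq, of u] comp_reduce[OF mq, of v] uv(6) by simp
  next
    fix W t assume t: "t \<in> hom C (Cod C u) W" "t \<cdot> u = t \<cdot> v"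
    obtain w where w: "w \<in> hom C I W" "w \<cdot> q = t"
      by (rule coequaliser_factor[OF q, of t W]) (use t in simp_all)
    note [simp] = w(1)[unfolded hom_iff]
    have "(w \<cdot> n) \<cdot> g = t"
      using w comp_reduce[OF n(2), of q] by (simp flip: mq)
    moreover have "x = w \<cdot> n" if x: "x \<in> hom C A W" "x \<cdot> g = t" for x
    proof -
      have "x \<cdot> m = w"
        by (rule coequaliser_unique[OF q(1), of _ W]) (use x w in \<open>auto simp flip: mq\<close>)
      then show ?thesis
        using x n(3) by auto
    qed
    ultimately show "\<exists>!w. w \<in> hom C (Cod C g) W \<and> w \<cdot> g = t"
      by (intro ex1I[of _ "w \<cdot> n"]) auto
  qed auto
  then show ?thesis by (auto simp: regular_epi_def)
qed

text \<open>The arrow \<open>t = 1 \<times> e\<close> is a pullback of \<open>e\<close>, hence a coequaliser. To factor the given \<open>\<phi>\<close> through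
  it, \<open>\<phi>\<close> must identify \<open>(x, w)\<close> with \<open>(x, w')\<close> whenever \<open>e w = e w'\<close>; by joint epicness it suffices
  to see this for \<open>w = w' = 0\<close> and for \<open>x = 0\<close>, where it is clear.\<close>

lemma huq_commute_along_regular_epi:
  assumes k: "k \<in> hom C X A" and l: "l \<in> hom C Y A" and e: "e \<in> hom C E Y" "regular_epi C e"
    and kle: "huq_commute C A k (l \<cdot> e)"
  shows "huq_commute C A k l"
proof -
  note [simp] = k[unfolded hom_iff] l[unfolded hom_iff] e(1)[unfolded hom_iff]
  have [simp]: "X \<in> Obj C" "Y \<in> Obj C" "E \<in> Obj C"
    using Obj_if_arr[of k] Obj_if_arr[of e] by auto
  obtain P p0 p1 \<phi> i j where P: "is_product C X E P p0 p1" and "\<phi> \<in> hom C P A"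
    "i \<in> hom C X P" and i: "p0 \<cdot> i = Id C X" "p1 \<cdot> i = zero_arr C X E" "\<phi> \<cdot> i = k" and
    "j \<in> hom C E P" and j: "p0 \<cdot> j = zero_arr C E X" "p1 \<cdot> j = Id C E" "\<phi> \<cdot> j = l \<cdot> e"
    by (rule huq_commuteE[OF kle, of X E]) auto
  note [simp] = \<open>\<phi> \<in> hom C P A\<close>[unfolded hom_iff] \<open>i \<in> hom C X P\<close>[unfolded hom_iff]
    \<open>j \<in> hom C E P\<close>[unfolded hom_iff] product_arr[OF P]
  obtain Q r0 r1 where Q: "is_product C X Y Q r0 r1"
    by (rule product_exists[of X Y]) auto
  note [simp] = product_arr[OF Q]
  obtain t where [simp]: "t \<in> Arr C" "Dom C t = P" "Cod C t = Q" and t: "r0 \<cdot> t = p0" "r1 \<cdot> t = e \<cdot> p1"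
    by (rule product_lift[OF Q, of p0 P "e \<cdot> p1"]) auto
  note t' = comp_reduce[OF t(1)] comp_reduce[OF t(2)]
  \<comment> \<open>The coequaliser property of \<open>t\<close>.\<close>
  have "is_pullback C e r1 P p1 t"
  proof (rule pullbackI[of _ _ E _ Q _ Y])
    fix W a b assume ab: "a \<in> hom C W E" "b \<in> hom C W Q" "e \<cdot> a = r1 \<cdot> b"
    obtain u where [simp]: "u \<in> Arr C" "Dom C u = W" "Cod C u = P" and u: "p0 \<cdot> u = r0 \<cdot> b" "p1 \<cdot> u = a"
      by (rule product_lift[OF P, of "r0 \<cdot> b" W a]) (use ab in auto)
    have "t \<cdot> u = b"
      by (rule product_ext[OF Q, of _ W]) (use ab u t' in auto)
    then show "\<exists>u. u \<in> hom C W P \<and> p1 \<cdot> u = a \<and> t \<cdot> u = b" using u by (intro exI[of _ u]) simp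
  next
    fix W u v assume uv: "u \<in> hom C W P" "v \<in> hom C W P" "p1 \<cdot> u = p1 \<cdot> v" "t \<cdot> u = t \<cdot> v"
    have "p0 \<cdot> u = p0 \<cdot> v"
      using uv t'(1)[of u] t'(1)[of v] by simp
    then show "u = v" using product_ext[OF P uv(1,2)] uv(3) by blast
  qed (auto simp: t)
  then have "regular_epi C t" using regular_epi_pullback e(2) by blast
  then obtain a b where co: "is_coequaliser C a b t" unfolding regular_epi_def by blast
  then have ab: "a \<in> Arr C" "b \<in> Arr C" "Dom C b = Dom C a" "Cod C a = P" "Cod C b = P" "t \<cdot> a = t \<cdot> b"
    unfolding is_coequaliser_def by auto
  define W where "W = Dom C a"
  note [simp] = ab(1,2,4,5) ab(3)[folded W_def] W_def[symmetric]
  \<comment> \<open>\<open>Z\<close> is the object of triples \<open>(x, w, w')\<close> with \<open>e w = e w'\<close>.\<close>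
  obtain E' u v where E': "is_pullback C e e E' u v"
    by (rule pullback_exists[of e e]) auto
  note [simp] = pullback_arr[OF E']
  note euv = pullback_comm[OF E']
  obtain Z z0 z1 where Z: "is_product C X E' Z z0 z1"
    by (rule product_exists[of X E']) auto
  note [simp] = product_arr[OF Z]
  obtain zi where [simp]: "zi \<in> Arr C" "Dom C zi = X" "Cod C zi = Z" and zi: "z0 \<cdot> zi = Id C X" "z1 \<cdot> zi = zero_arr C X E'"
    by (rule product_lift[OF Z, of "Id C X" X "zero_arr C X E'"]) auto
  obtain zj where [simp]: "zj \<in> Arr C" "Dom C zj = E'" "Cod C zj = Z" and zj: "z0 \<cdot> zj = zero_arr C E' X" "z1 \<cdot> zj = Id C E'"
    by (rule product_lift[OF Z, of "zero_arr C E' X" E' "Id C E'"]) auto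
  obtain U where [simp]: "U \<in> Arr C" "Dom C U = Z" "Cod C U = P" and U: "p0 \<cdot> U = z0" "p1 \<cdot> U = u \<cdot> z1"
    by (rule product_lift[OF P, of z0 Z "u \<cdot> z1"]) auto
  obtain V where [simp]: "V \<in> Arr C" "Dom C V = Z" "Cod C V = P" and V: "p0 \<cdot> V = z0" "p1 \<cdot> V = v \<cdot> z1"
    by (rule product_lift[OF P, of z0 Z "v \<cdot> z1"]) auto
  note UV' = comp_reduce[OF U(1)] comp_reduce[OF U(2)] comp_reduce[OF V(1)] comp_reduce[OF V(2)]
  note ij' = comp_reduce[OF i(1)] comp_reduce[OF i(2)] comp_reduce[OF j(1)] comp_reduce[OF j(2)]
  have ker: "is_kernel C z1 X zi"
    by (rule product_kernel[OF Z]) (auto simp: zi)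
  have "U \<cdot> zi = i" "V \<cdot> zi = i" "U \<cdot> zj = j \<cdot> u" "V \<cdot> zj = j \<cdot> v"
    by (rule product_ext[OF P, of _ X] product_ext[OF P, of _ E']; simp add: UV' ij' zi zj i j)+
  moreover have "\<phi> \<cdot> (j \<cdot> u) = \<phi> \<cdot> (j \<cdot> v)"
    by (simp add: comp_reduce[OF j(3)] euv)
  ultimately have "(\<phi> \<cdot> U) \<cdot> zi = (\<phi> \<cdot> V) \<cdot> zi" "(\<phi> \<cdot> U) \<cdot> zj = (\<phi> \<cdot> V) \<cdot> zj"
    by simp_all
  moreover have "split_epi C Z E' z1 zj" by (simp add: split_epi_def zj)
  ultimately have \<phi>UV: "\<phi> \<cdot> U = \<phi> \<cdot> V"
    using jointly_epic[OF _ ker] by simp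
  have p0ab: "p0 \<cdot> a = p0 \<cdot> b" "e \<cdot> (p1 \<cdot> a) = e \<cdot> (p1 \<cdot> b)"
    using t'(1)[of a] t'(1)[of b] t'(2)[of a] t'(2)[of b] ab(6) by simp_all
  obtain w where [simp]: "w \<in> Arr C" "Dom C w = W" "Cod C w = E'" and w: "u \<cdot> w = p1 \<cdot> a" "v \<cdot> w = p1 \<cdot> b"
    by (rule pullback_lift[OF E', of "p1 \<cdot> a" W "p1 \<cdot> b"]) (auto simp: p0ab)
  obtain x where [simp]: "x \<in> Arr C" "Dom C x = W" "Cod C x = Z" and x: "z0 \<cdot> x = p0 \<cdot> a" "z1 \<cdot> x = w"
    by (rule product_lift[OF Z, of "p0 \<cdot> a" W w]) auto
  have "U \<cdot> x = a" "V \<cdot> x = b"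
    by (rule product_ext[OF P, of _ W]; simp add: UV' x w p0ab)+
  then have "\<phi> \<cdot> a = \<phi> \<cdot> b"
    using comp_reduce[OF \<phi>UV, of x] by simp
  then obtain \<psi> where \<psi>: "\<psi> \<in> hom C Q A" "\<psi> \<cdot> t = \<phi>"
    by (rule coequaliser_factor[OF co, of P Q \<phi> A, rotated 2]) simp_all
  note [simp] = \<psi>(1)[unfolded hom_iff]
  obtain j' where [simp]: "j' \<in> Arr C" "Dom C j' = Y" "Cod C j' = Q" and j': "r0 \<cdot> j' = zero_arr C Y X" "r1 \<cdot> j' = Id C Y"
    by (rule product_lift[OF Q, of "zero_arr C Y X" Y "Id C Y"]) auto
  have "j' \<cdot> e = t \<cdot> j"
    by (rule product_ext[OF Q, of _ E]) (auto simp: t' comp_reduce[OF j'(1)] comp_reduce[OF j'(2)] j)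
  then have "(\<psi> \<cdot> j') \<cdot> e = l \<cdot> e"
    using comp_reduce[OF \<psi>(2), of j] j(3) by simp
  then have "\<psi> \<cdot> j' = l"
    using regular_epi_epic[OF e(2), of "\<psi> \<cdot> j'" A l] by simp
  then show ?thesis
    by (intro huq_commuteI[OF Q \<psi>(1), of "t \<cdot> i" k j' l])
      (use i comp_reduce[OF \<psi>(2), of i] in \<open>auto simp: t' j'\<close>)
qed

section \<open>The kernels of a star-multiplicative graph commute\<close>

text \<open>For \<open>y\<close> in the kernel of \<open>c\<close> and \<open>f\<close> in that of \<open>d\<close> with \<open>c f = d y\<close>, put \<open>n = y f\<close>. Then
  \<open>y = n f\<^sup>-\<^sup>1\<close>, and \<open>x y = (x n) f\<^sup>-\<^sup>1\<close> uses only star multiplication and the division it induces.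
  Such an \<open>f\<close> depends on a choice: it can be found for \<open>y\<close> only after covering the kernel of \<open>c\<close> by a
  regular epimorphism.\<close>

lemma huq_commute_if_star_multiplicative:
  assumes star: "star_multiplicative C C1 C0 d c e" and L: "is_kernel C c Y l"
  obtains X k where "is_kernel C d X k" "huq_commute C C1 k l"
proof -
  have G: "reflexive_graph C C1 C0 d c e" using star unfolding star_multiplicative_def by blast
  note [simp] = reflexive_graphD(1-9,12,13)[OF G] kernel_arr(2,3,5)[OF L]
  note de = reflexive_graphD(10)[OF G] and ce = reflexive_graphD(11)[OF G]
  note de' = comp_reduce[OF de] and ce' = comp_reduce[OF ce]
  have [simp]: "Cod C l = C1" using kernel_arr(4)[OF L] by simp
  have cl: "c \<cdot> l = zero_arr C Y C0" using kernel_arr(6)[OF L] by simp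
  obtain X k P p0 p1 \<sigma> u v where K: "is_kernel C d X k" and P: "is_pullback C d (c \<cdot> k) P p0 p1"
    and \<sigma>_hom: "\<sigma> \<in> hom C P X"
    and u: "u \<in> hom C X P" "p0 \<cdot> u = k" "p1 \<cdot> u = zero_arr C X X" "\<sigma> \<cdot> u = Id C X"
    and v: "v \<in> hom C X P" "p0 \<cdot> v = e \<cdot> (c \<cdot> k)" "p1 \<cdot> v = Id C X" "\<sigma> \<cdot> v = Id C X"
    by (rule star_multiplicativeE[OF star])
  note [simp] = kernel_arr(2,3,5)[OF K] \<sigma>_hom[unfolded hom_iff] u(1)[unfolded hom_iff] v(1)[unfolded hom_iff]
    pullback_arr(3,4,6,10)[OF P]
  have [simp]: "Cod C k = C1" using kernel_arr(4)[OF K] by simp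
  have [simp]: "Cod C p0 = C1" "Dom C p1 = P" "Cod C p1 = X" using pullback_arr[OF P] by simp_all
  have dk: "d \<cdot> k = zero_arr C X C0" using kernel_arr(6)[OF K] by simp
  note dk' = comp_reduce[OF dk] and cl' = comp_reduce[OF cl]
  note uv' = u(2-4)[THEN comp_reduce] v(2-4)[THEN comp_reduce]
  have P_split: "split_epi C P X p1 v" by (simp add: split_epi_def v)
  have P_ker: "is_kernel C p1 X u"
    by (rule pullback_kernel[OF P K]) (auto simp: u)
  have c\<sigma>: "c \<cdot> (k \<cdot> \<sigma>) = c \<cdot> p0"
    by (rule jointly_epic[OF P_split P_ker, of _ C0]) (auto simp: u v ce')
  note c\<sigma>' = comp_reduce[OF c\<sigma>]

  obtain Q x0 x1 where Q: "is_product C X X Q x0 x1"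
    by (rule product_exists[of X X]) auto
  note [simp] = product_arr[OF Q]
  obtain \<Delta> where [simp]: "\<Delta> \<in> Arr C" "Dom C \<Delta> = X" "Cod C \<Delta> = Q" and \<Delta>: "x0 \<cdot> \<Delta> = Id C X" "x1 \<cdot> \<Delta> = Id C X"
    by (rule product_lift[OF Q, of "Id C X" X "Id C X"]) auto
  obtain \<omega> where [simp]: "\<omega> \<in> Arr C" "Dom C \<omega> = P" "Cod C \<omega> = Q" and \<omega>: "x0 \<cdot> \<omega> = \<sigma>" "x1 \<cdot> \<omega> = p1"
    by (rule product_lift[OF Q, of \<sigma> P p1]) auto
  note \<omega>' = \<omega>[THEN comp_reduce]
  \<comment> \<open>\<open>\<omega>(g, f) = (g f, f)\<close> is inverted by \<open>\<delta>(x, f) = (x f\<^sup>-\<^sup>1, f)\<close>.\<close>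
  have "is_iso C \<omega>"
  proof (rule iso_if_iso_on_base_and_kernel[OF P_split P_ker, where f' = x1 and s' = \<Delta> and b = "Id C X"])
    show "split_epi C Q X x1 \<Delta>" by (simp add: split_epi_def \<Delta>)
    show "is_kernel C x1 X (\<omega> \<cdot> u)"
      by (rule product_kernel[OF Q]) (auto simp: \<omega>' u)
    show "\<Delta> \<cdot> Id C X = \<omega> \<cdot> v"
      by (rule product_ext[OF Q, of _ X]) (auto simp: \<Delta> \<omega>' v)
  qed (auto simp: iso_Id \<omega>)
  then obtain \<delta> where \<delta>_hom: "\<delta> \<in> hom C Q P" and \<delta>: "\<delta> \<cdot> \<omega> = Id C P"
    by (rule is_isoE[of \<omega> P Q]) auto
  note [simp] = \<delta>_hom[unfolded hom_iff]
  note \<delta>' = comp_reduce[OF \<delta>]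

  \<comment> \<open>\<open>H\<close> is the object of triples \<open>(y, y', g)\<close> with \<open>g\<close> from \<open>d y\<close> to \<open>d y'\<close>. Its projection to \<open>Y \<times> Y\<close> is
    a regular epimorphism, since the pairs \<open>(y, 0)\<close> and \<open>(y, y)\<close> lift, with \<open>g = y\<close> and \<open>g = e d y\<close>.\<close>
  obtain YY y0 y1 where YY: "is_product C Y Y YY y0 y1"
    by (rule product_exists[of Y Y]) auto
  note [simp] = product_arr[OF YY]
  obtain yi where [simp]: "yi \<in> Arr C" "Dom C yi = Y" "Cod C yi = YY" and yi: "y0 \<cdot> yi = Id C Y" "y1 \<cdot> yi = zero_arr C Y Y"
    by (rule product_lift[OF YY, of "Id C Y" Y "zero_arr C Y Y"]) auto
  obtain yj where [simp]: "yj \<in> Arr C" "Dom C yj = Y" "Cod C yj = YY" and yj: "y0 \<cdot> yj = zero_arr C Y Y" "y1 \<cdot> yj = Id C Y"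
    by (rule product_lift[OF YY, of "zero_arr C Y Y" Y "Id C Y"]) auto
  obtain y\<Delta> where [simp]: "y\<Delta> \<in> Arr C" "Dom C y\<Delta> = Y" "Cod C y\<Delta> = YY" and y\<Delta>: "y0 \<cdot> y\<Delta> = Id C Y" "y1 \<cdot> y\<Delta> = Id C Y"
    by (rule product_lift[OF YY, of "Id C Y" Y "Id C Y"]) auto
  note yj' = yj[THEN comp_reduce]
  obtain CC o0 o1 where CC: "is_product C C0 C0 CC o0 o1"
    by (rule product_exists[of C0 C0]) auto
  note [simp] = product_arr[OF CC]
  obtain dd where [simp]: "dd \<in> Arr C" "Dom C dd = YY" "Cod C dd = CC"
      and dd: "o0 \<cdot> dd = d \<cdot> (l \<cdot> y0)" "o1 \<cdot> dd = d \<cdot> (l \<cdot> y1)"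
    by (rule product_lift[OF CC, of "d \<cdot> (l \<cdot> y0)" YY "d \<cdot> (l \<cdot> y1)"]) auto
  obtain dc where [simp]: "dc \<in> Arr C" "Dom C dc = C1" "Cod C dc = CC" and dc: "o0 \<cdot> dc = d" "o1 \<cdot> dc = c"
    by (rule product_lift[OF CC, of d C1 c]) auto
  note ddc' = dd[THEN comp_reduce] dc[THEN comp_reduce]
  obtain H g0 g1 where H: "is_pullback C dd dc H g0 g1"
    by (rule pullback_exists[of dd dc]) auto
  note [simp] = pullback_arr(3,4,6,10)[OF H]
  have [simp]: "Cod C g0 = YY" "Dom C g1 = H" "Cod C g1 = C1" using pullback_arr[OF H] by simp_all
  have g: "d \<cdot> g1 = d \<cdot> (l \<cdot> (y0 \<cdot> g0))" "c \<cdot> g1 = d \<cdot> (l \<cdot> (y1 \<cdot> g0))"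
    using ddc'[of g0] ddc'[of g1] pullback_comm[OF H] by simp_all
  note g' = g[THEN comp_reduce]
  have "dd \<cdot> yi = dc \<cdot> l" "dd \<cdot> y\<Delta> = dc \<cdot> (e \<cdot> (d \<cdot> l))"
    by (rule product_ext[OF CC, of _ Y]; simp add: ddc' yi y\<Delta> cl de' ce')+
  obtain hi where hi: "hi \<in> Arr C" "Dom C hi = Y" "Cod C hi = H" "g0 \<cdot> hi = yi" "g1 \<cdot> hi = l"
    by (rule pullback_lift[OF H, of yi Y l]) (use \<open>dd \<cdot> yi = dc \<cdot> l\<close> in auto)
  obtain h\<Delta> where h\<Delta>: "h\<Delta> \<in> Arr C" "Dom C h\<Delta> = Y" "Cod C h\<Delta> = H" "g0 \<cdot> h\<Delta> = y\<Delta>" "g1 \<cdot> h\<Delta> = e \<cdot> (d \<cdot> l)"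
    by (rule pullback_lift[OF H, of y\<Delta> Y "e \<cdot> (d \<cdot> l)"]) (use \<open>dd \<cdot> y\<Delta> = _\<close> in auto)
  have YY_split: "split_epi C YY Y y1 y\<Delta>" by (simp add: split_epi_def y\<Delta>)
  have YY_ker: "is_kernel C y1 Y yi" by (rule product_kernel[OF YY]) (auto simp: yi)
  have "regular_epi C g0"
    by (rule regular_epi_if_lifts[OF YY_split YY_ker, of g0 H hi h\<Delta>]) (use hi h\<Delta> in auto)
  \<comment> \<open>The fibre over the pairs \<open>(0, y)\<close>: here \<open>g\<close> goes from \<open>0\<close> to \<open>d y\<close>, so it is the required \<open>f\<close>.\<close>
  obtain E f0 f1 where E: "is_pullback C g0 yj E f0 f1"
    by (rule pullback_exists[of g0 yj]) auto
  note [simp] = pullback_arr(3,4,6,10)[OF E]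
  have [simp]: "Cod C f0 = H" "Dom C f1 = E" "Cod C f1 = Y" using pullback_arr[OF E] by simp_all
  have f1: "regular_epi C f1"
    by (rule regular_epi_pullback[OF E \<open>regular_epi C g0\<close>])
  have gf: "g0 \<cdot> f0 = yj \<cdot> f1" by (rule pullback_comm[OF E])
  obtain f where [simp]: "f \<in> Arr C" "Dom C f = E" "Cod C f = X" and f: "k \<cdot> f = g1 \<cdot> f0"
    by (rule kernel_lift[OF K, of "g1 \<cdot> f0" E]) (auto simp: g' gf yj')
  have cf: "c \<cdot> (k \<cdot> f) = d \<cdot> (l \<cdot> f1)"
    by (simp add: f g' gf yj')

  obtain \<nu> where [simp]: "\<nu> \<in> Arr C" "Dom C \<nu> = E" "Cod C \<nu> = P" and \<nu>: "p0 \<cdot> \<nu> = l \<cdot> f1" "p1 \<cdot> \<nu> = f"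
    by (rule pullback_lift[OF P, of "l \<cdot> f1" E f]) (auto simp: cf)
  \<comment> \<open>\<open>n = y f\<close>.\<close>
  define n where "n = \<sigma> \<cdot> \<nu>"
  have [simp]: "n \<in> Arr C" "Dom C n = E" "Cod C n = X" by (simp_all add: n_def)
  have cn: "c \<cdot> (k \<cdot> n) = zero_arr C E C0"
    using c\<sigma>'[of \<nu>] by (simp add: n_def \<nu> cl')
  \<comment> \<open>\<open>p0 \<delta> \<eta>\<close> maps \<open>(x, (y, f))\<close> to \<open>(x n) f\<^sup>-\<^sup>1\<close>.\<close>
  obtain B b0 b1 where B: "is_product C X E B b0 b1"
    by (rule product_exists[of X E]) auto
  note [simp] = product_arr[OF B]
  obtain bi where [simp]: "bi \<in> Arr C" "Dom C bi = X" "Cod C bi = B" and bi: "b0 \<cdot> bi = Id C X" "b1 \<cdot> bi = zero_arr C X E"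
    by (rule product_lift[OF B, of "Id C X" X "zero_arr C X E"]) auto
  obtain bj where [simp]: "bj \<in> Arr C" "Dom C bj = E" "Cod C bj = B" and bj: "b0 \<cdot> bj = zero_arr C E X" "b1 \<cdot> bj = Id C E"
    by (rule product_lift[OF B, of "zero_arr C E X" E "Id C E"]) auto
  have cnb: "c \<cdot> (k \<cdot> (n \<cdot> b1)) = zero_arr C B C0"
    using comp_reduce[OF cn, of b1] by simp
  obtain \<xi> where [simp]: "\<xi> \<in> Arr C" "Dom C \<xi> = B" "Cod C \<xi> = P" and \<xi>: "p0 \<cdot> \<xi> = k \<cdot> b0" "p1 \<cdot> \<xi> = n \<cdot> b1"
    by (rule pullback_lift[OF P, of "k \<cdot> b0" B "n \<cdot> b1"]) (auto simp: dk' cnb)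
  note \<xi>' = \<xi>[THEN comp_reduce]
  obtain \<eta> where [simp]: "\<eta> \<in> Arr C" "Dom C \<eta> = B" "Cod C \<eta> = Q" and \<eta>: "x0 \<cdot> \<eta> = \<sigma> \<cdot> \<xi>" "x1 \<cdot> \<eta> = f \<cdot> b1"
    by (rule product_lift[OF Q, of "\<sigma> \<cdot> \<xi>" B "f \<cdot> b1"]) auto
  note \<eta>' = \<eta>[THEN comp_reduce]
  have \<xi>i: "\<xi> \<cdot> bi = u"
    by (rule pullback_ext[OF P, of _ X]) (auto simp: \<xi>' bi u)
  have \<xi>j: "\<xi> \<cdot> bj = v \<cdot> n"
    by (rule pullback_ext[OF P, of _ E]) (auto simp: \<xi>' bj uv' cn)
  have \<eta>i: "\<eta> \<cdot> bi = \<omega> \<cdot> u"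
    by (rule product_ext[OF Q, of _ X]) (auto simp: \<eta>' \<xi>i bi u \<omega>')
  have \<eta>j: "\<eta> \<cdot> bj = \<omega> \<cdot> \<nu>"
    by (rule product_ext[OF Q, of _ E]) (auto simp: \<eta>' \<xi>j bj uv' \<omega>' \<nu> n_def)
  have "huq_commute C C1 k (l \<cdot> f1)"
    by (rule huq_commuteI[OF B, of "p0 \<cdot> (\<delta> \<cdot> \<eta>)" C1 bi k bj])
      (auto simp: bi bj \<eta>i \<eta>j \<delta>' u \<nu>)
  then have "huq_commute C C1 k l"
    using huq_commute_along_regular_epi[of k X C1 l Y f1 E] f1 by simp
  with K show thesis by (rule that)
qed

end

section \<open>The equivalence of the two conditions\<close>

lemma semi_abelian_regular_protomodular:
  "semi_abelian \<A> \<Longrightarrow> regular_protomodular_category \<A>"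
  unfolding semi_abelian_def protomodular_def barr_exact_def
  by (simp add: regular_protomodular_category_def protomodular_category_def
      pointed_finitely_complete_category_def pointed_finitely_complete_category_axioms_def
      protomodular_category_axioms_def regular_protomodular_category_axioms_def)

theorem theorem2p11:
  fixes \<A> :: "('o, 'm) precategory"
  assumes "semi_abelian \<A>"
  shows
    "(\<forall>C1 C0 d c e. reflexive_graph \<A> C1 C0 d c e \<and> star_multiplicative \<A> C1 C0 d c e \<longrightarrow>
        multiplicative \<A> C1 C0 d c e)
     \<longleftrightarrow>
     (\<forall>A R r0 r1 \<Delta>R S s0 s1 \<Delta>S nR nS.
        equivalence_relation \<A> A R r0 r1 \<Delta>R \<and> equivalence_relation \<A> A S s0 s1 \<Delta>S \<and>
        is_normalisation \<A> r0 r1 nR \<and> is_normalisation \<A> s0 s1 nS \<longrightarrow>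
        (smith_commute \<A> A R r0 r1 \<Delta>R S s0 s1 \<Delta>S \<longleftrightarrow> huq_commute \<A> A nR nS))"
    (is "?SM \<longleftrightarrow> ?SH")
proof -
  interpret regular_protomodular_category \<A>
    by (rule semi_abelian_regular_protomodular) (rule assms)
  show ?thesis
  proof
    assume SM: ?SM
    show ?SH
    proof (intro allI impI, elim conjE)
      fix A R r0 r1 \<Delta>R S s0 s1 \<Delta>S nR nS
      assume R: "equivalence_relation \<A> A R r0 r1 \<Delta>R" and S: "equivalence_relation \<A> A S s0 s1 \<Delta>S"
        and nR: "is_normalisation \<A> r0 r1 nR" and nS: "is_normalisation \<A> s0 s1 nS"
      obtain K k where K: "is_kernel \<A> r0 K k" and k: "nR = r1 \<cdot>\<^bsub>\<A>\<^esub> k"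
        using nR unfolding is_normalisation_def by blast
      obtain L l where L: "is_kernel \<A> s0 L l" and l: "nS = s1 \<cdot>\<^bsub>\<A>\<^esub> l"
        using nS unfolding is_normalisation_def by blast
      note [simp] = equivalence_relationD(1-11,13,14)[OF R] equivalence_relationD(1-11,13,14)[OF S]
      obtain P p q where P: "is_pullback \<A> r1 s0 P p q"
        by (rule pullback_exists[of r1 s0]) auto
      note [simp] = pullback_arr[OF P]
      obtain e where e: "e \<in> Arr \<A>" "Dom \<A> e = A" "Cod \<A> e = P" "p \<cdot>\<^bsub>\<A>\<^esub> e = \<Delta>R" "q \<cdot>\<^bsub>\<A>\<^esub> e = \<Delta>S"
        by (rule pullback_lift[OF P, of \<Delta>R A \<Delta>S]) auto
      then have e_hom: "e \<in> hom \<A> A P" by simp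
      show "smith_commute \<A> A R r0 r1 \<Delta>R S s0 s1 \<Delta>S \<longleftrightarrow> huq_commute \<A> A nR nS"
      proof
        assume "smith_commute \<A> A R r0 r1 \<Delta>R S s0 s1 \<Delta>S"
        then show "huq_commute \<A> A nR nS"
          unfolding k l by (rule huq_commute_if_smith_commute[OF R S K L])
      next
        assume "huq_commute \<A> A nR nS"
        then have "star_multiplicative \<A> P A (r0 \<cdot>\<^bsub>\<A>\<^esub> p) (s1 \<cdot>\<^bsub>\<A>\<^esub> q) e"
          unfolding k l by (rule zigzag_graph_star_multiplicative[OF R S P e_hom e(4,5) K L])
        then have "multiplicative \<A> P A (r0 \<cdot>\<^bsub>\<A>\<^esub> p) (s1 \<cdot>\<^bsub>\<A>\<^esub> q) e"
          using SM unfolding star_multiplicative_def by blast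
        then show "smith_commute \<A> A R r0 r1 \<Delta>R S s0 s1 \<Delta>S"
          by (rule smith_commute_if_zigzag_graph_multiplicative[OF R S P e_hom e(4,5)])
      qed
    qed
  next
    assume SH: ?SH
    show ?SM
    proof (intro allI impI, elim conjE)
      fix C1 C0 d c e
      assume G: "reflexive_graph \<A> C1 C0 d c e" and star: "star_multiplicative \<A> C1 C0 d c e"
      have d: "d \<in> hom \<A> C1 C0" and c: "c \<in> hom \<A> C1 C0"
        using G unfolding reflexive_graph_def by blast+
      obtain Y l where L: "is_kernel \<A> c Y l"
        by (rule kernel_exists[OF c])
      obtain X k where K: "is_kernel \<A> d X k" and kl: "huq_commute \<A> C1 k l"
        by (rule huq_commute_if_star_multiplicative[OF star L])
      obtain R r0 r1 \<Delta>R where Rpb: "is_pullback \<A> d d R r0 r1"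
          and R: "equivalence_relation \<A> C1 R r0 r1 \<Delta>R" "is_normalisation \<A> r0 r1 k"
        by (rule kernel_pair_of_arrow[OF d K])
      obtain S s0 s1 \<Delta>S where Spb: "is_pullback \<A> c c S s0 s1"
          and S: "equivalence_relation \<A> C1 S s0 s1 \<Delta>S" "is_normalisation \<A> s0 s1 l"
        by (rule kernel_pair_of_arrow[OF c L])
      have "smith_commute \<A> C1 R r0 r1 \<Delta>R S s0 s1 \<Delta>S"
        using SH R S kl by blast
      then show "multiplicative \<A> C1 C0 d c e"
        by (rule multiplicative_if_kernel_pairs_smith_commute[OF G Rpb R(1) Spb S(1)])
    qed
  qed
qed

end
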